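(* Let $A,B$ be real symmetric $4\times 4$ matrices defining quadrics $\mathcal A: X^TAX=0$, $\mathcal B: X^TBX=0$ in $\mathbb{PR}^3$ with $f(\lambda)=\det(\lambda A-B)$ not identically zero. If $f(\lambda)=0$ has a real double root $\lambda_0$ and a pair of complex conjugate roots with Segre characteristic $[(11)11]$, then the possible index sequences of the pencil $\lambda A-B$ are $\langle 1||3\rangle$ and $\langle 2||2\rangle$. Furthermore: (1) when the index sequence is $\langle 1||3\rangle$, the QSIC consists of two conics, one real and one imaginary; (2) when the index sequence is $\langle 2||2\rangle$, the QSIC consists of two real conics which cannot both be ellipses simultaneously in any affine realization of $\mathbb{PR}^3$.
   Context: $X=(x,y,z,w)^T$ homogeneous coordinates; QSIC $=\mathcal A\cap\mathcal B$. One may take $A$ nonsingular. Segre characteristic $[(11)11]$: the double root has two $1\times1$ Jordan blocks (of $A^{-1}B$) and the other two roots are simple. $\mathrm{Id}(\lambda)$ = number of positive eigenvalues of $\lambda A-B$; with the single real root $\lambda_0$, the index sequence is $\langle s_0\,||\,s_1\rangle$, $s_0,s_1$ the values of $\mathrm{Id}$ on $(-\infty,\lambda_0)$ and $(\lambda_0,\infty)$, up to the equivalence induced by change of basis of the pencil (including reversal and complement $s\mapsto4-s$). A conic is real if it has infinitely many real points, imaginary otherwise. An affine realization of $\mathbb{PR}^3$ is obtained by declaring a real plane to be the plane at infinity; a real conic is an ellipse in it if it has no real point on that plane. *)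

theory Defs
  imports "HOL-Analysis.Analysis"
begin

text \<open>Real symmetric 4x4 matrices are of type real^4^4; homogeneous coordinates
  of points of complex projective 3-space are nonzero vectors of complex^4
  (a projective point is represented by all its nonzero multiples).\<close>

definition sym4 :: "real^4^4 \<Rightarrow> bool" where
  "sym4 M \<longleftrightarrow> transpose M = M"

definition cvec :: "real^4 \<Rightarrow> complex^4" where
  "cvec x = (\<chi> i. complex_of_real (x $ i))"

definition cquad :: "real^4^4 \<Rightarrow> complex^4 \<Rightarrow> complex" where
  "cquad M z = (\<Sum>i\<in>UNIV. \<Sum>j\<in>UNIV. z $ i * complex_of_real (M $ i $ j) * z $ j)"

definition QSIC :: "real^4^4 \<Rightarrow> real^4^4 \<Rightarrow> (complex^4) set" where
  "QSIC A B = {z. z \<noteq> 0 \<and> cquad A z = 0 \<and> cquad B z = 0}"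

definition cbil :: "complex^4^4 \<Rightarrow> complex^4 \<Rightarrow> complex^4 \<Rightarrow> complex" where
  "cbil Q z w = (\<Sum>i\<in>UNIV. \<Sum>j\<in>UNIV. z $ i * Q $ i $ j * w $ j)"

definition clin :: "complex^4 \<Rightarrow> complex^4 \<Rightarrow> complex" where
  "clin p z = (\<Sum>i\<in>UNIV. p $ i * z $ i)"

definition conic_set :: "complex^4 \<Rightarrow> complex^4^4 \<Rightarrow> (complex^4) set" where
  "conic_set p Q = {z. z \<noteq> 0 \<and> clin p z = 0 \<and> cbil Q z z = 0}"

definition is_conic :: "(complex^4) set \<Rightarrow> bool" where
  "is_conic C \<longleftrightarrow> (\<exists>p Q. p \<noteq> 0 \<and> transpose Q = Q \<and>
     (\<forall>w. w \<noteq> 0 \<and> clin p w = 0 \<longrightarrow> (\<exists>v. clin p v = 0 \<and> cbil Q w v \<noteq> 0)) \<and>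
     C = conic_set p Q)"

definition real_pts :: "(complex^4) set \<Rightarrow> (real^4) set" where
  "real_pts C = {x. x \<noteq> 0 \<and> cvec x \<in> C}"

definition pclass :: "real^4 \<Rightarrow> (real^4) set" where
  "pclass x = {y. \<exists>c. c \<noteq> 0 \<and> y = c *\<^sub>R x}"

definition real_conic :: "(complex^4) set \<Rightarrow> bool" where
  "real_conic C \<longleftrightarrow> infinite (pclass ` real_pts C)"

definition imaginary_conic :: "(complex^4) set \<Rightarrow> bool" where
  "imaginary_conic C \<longleftrightarrow> \<not> real_conic C"

text \<open>Affine realization: the real plane h.X = 0 (h nonzero) is declared the
  plane at infinity; a real conic is an ellipse if it has no real point on it.\<close>
definition ellipse_in :: "real^4 \<Rightarrow> (complex^4) set \<Rightarrow> bool" where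
  "ellipse_in h C \<longleftrightarrow> real_conic C \<and> (\<forall>x\<in>real_pts C. h \<bullet> x \<noteq> 0)"

definition pos_eig :: "real^4^4 \<Rightarrow> nat" where
  "pos_eig M = (THE k. \<exists>P D. orthogonal_matrix P \<and> (\<forall>i j. i \<noteq> j \<longrightarrow> D $ i $ j = 0) \<and>
      M = P ** D ** transpose P \<and> k = card {i. D $ i $ i > 0})"

definition Id :: "real^4^4 \<Rightarrow> real^4^4 \<Rightarrow> real \<Rightarrow> nat" where
  "Id A B t = pos_eig (t *\<^sub>R A - B)"

definition has_index_seq :: "real^4^4 \<Rightarrow> real^4^4 \<Rightarrow> real \<Rightarrow> nat \<Rightarrow> nat \<Rightarrow> bool" where
  "has_index_seq A B l0 s0 s1 \<longleftrightarrow>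
     (\<forall>t. t < l0 \<longrightarrow> Id A B t = s0) \<and> (\<forall>t. t > l0 \<longrightarrow> Id A B t = s1)"

definition seq_equiv :: "nat \<times> nat \<Rightarrow> nat \<times> nat \<Rightarrow> bool" where
  "seq_equiv s t \<longleftrightarrow> t \<in> {(fst s, snd s), (snd s, fst s),
                          (4 - fst s, 4 - snd s), (4 - snd s, 4 - fst s)}"

definition index_seq_is :: "real^4^4 \<Rightarrow> real^4^4 \<Rightarrow> real \<Rightarrow> nat \<Rightarrow> nat \<Rightarrow> bool" where
  "index_seq_is A B l0 s0 s1 \<longleftrightarrow>
     (\<exists>t0 t1. seq_equiv (s0, s1) (t0, t1) \<and> has_index_seq A B l0 t0 t1)"

definition num_jordan_blocks :: "real^4^4 \<Rightarrow> real \<Rightarrow> nat" where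
  "num_jordan_blocks M l0 = dim {v. M *v v = l0 *\<^sub>R v}"

end

theory Submission
  imports Defs
begin

text \<open>Put \<open>C = l0 A - B\<close>, so that the pencil is \<open>s A + C\<close> with \<open>s = t - l0\<close>. The kernel of \<open>C\<close> is
  a plane on which \<open>A\<close> is nondegenerate, because \<open>s\<close> divides the determinant only twice. On the
  \<open>A\<close>-orthogonal complement of the kernel the determinant of the pencil has no real zero; this makes
  it negative, so \<open>C\<close> is a product of two real linear forms there. In suitable coordinates \<open>C\<close> is
  a multiple of \<open>z w\<close> and \<open>A\<close> is \<open>e\<^sub>1 x\<^sup>2 + e\<^sub>2 y\<^sup>2 + p z\<^sup>2 + 2 q z w + r w\<^sup>2\<close> with \<open>p r < 0\<close>. The complement
  contributes one positive eigenvalue for every \<open>s\<close>, and the signs of \<open>s e\<^sub>1\<close> and \<open>s e\<^sub>2\<close> decide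
  the rest. The two conics are \<open>e\<^sub>1 x\<^sup>2 + e\<^sub>2 y\<^sup>2 + r w\<^sup>2 = 0\<close> in \<open>z = 0\<close> and
  \<open>e\<^sub>1 x\<^sup>2 + e\<^sub>2 y\<^sup>2 + p z\<^sup>2 = 0\<close> in \<open>w = 0\<close>. If \<open>e\<^sub>1 e\<^sub>2 < 0\<close> and a real plane misses the real points
  of both, then the first two coefficients \<open>\<eta>, \<theta>\<close> of its equation satisfy both
  \<open>\<theta>\<^sup>2 \<bar>e\<^sub>1\<bar> > \<eta>\<^sup>2 \<bar>e\<^sub>2\<bar>\<close> and the opposite inequality.\<close>

subsection \<open>Symmetric bilinear forms and inertia\<close>

definition bil :: "real^'n^'n \<Rightarrow> real^'n \<Rightarrow> real^'n \<Rightarrow> real" where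
  "bil M x y = x \<bullet> (M *v y)"

lemma bil_add_left: "bil M (x + y) z = bil M x z + bil M y z"
  and bil_add_right: "bil M x (y + z) = bil M x y + bil M x z"
  and bil_diff_left: "bil M (x - y) z = bil M x z - bil M y z"
  and bil_diff_right: "bil M x (y - z) = bil M x y - bil M x z"
  and bil_scale_left: "bil M (c *\<^sub>R x) y = c * bil M x y"
  and bil_scale_right: "bil M x (c *\<^sub>R y) = c * bil M x y"
  and bil_zero_left: "bil M 0 y = 0"
  and bil_zero_right: "bil M x 0 = 0"
  by (simp_all add: bil_def inner_add_left inner_add_right inner_diff_left inner_diff_right
      matrix_vector_right_distrib matrix_vector_mult_diff_distrib matrix_vector_mult_scaleR)

lemmas bil_simps = bil_add_left bil_add_right bil_diff_left bil_diff_right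
  bil_scale_left bil_scale_right bil_zero_left bil_zero_right

lemma bil_commute:
  assumes "transpose M = M"
  shows "bil M x y = bil M y x"
  unfolding bil_def
  by (metis assms dot_lmul_matrix inner_commute transpose_matrix_vector)

lemma bil_sum_left: "bil M (\<Sum>i\<in>I. f i) y = (\<Sum>i\<in>I. bil M (f i) y)"
  by (simp add: bil_def inner_sum_left)

lemma bil_sum_right: "bil M x (\<Sum>i\<in>I. f i) = (\<Sum>i\<in>I. bil M x (f i))"
  by (induction I rule: infinite_finite_induct) (auto simp: bil_simps)

lemma bil_matrix_add: "bil (M + N) x y = bil M x y + bil N x y"
  and bil_matrix_scale: "bil (c *\<^sub>R M) x y = c * bil M x y"
  by (simp_all add: bil_def matrix_vector_mult_add_rdistrib
      inner_add_right scaleR_matrix_vector_assoc [symmetric])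

lemma matrix_congruence_nth:
  "(transpose T ** M ** T) $ i $ j = bil M (column i T) (column j T)"
proof -
  have "(transpose T ** M ** T) $ i $ j = axis i 1 \<bullet> ((transpose T ** M ** T) *v axis j 1)"
    by (simp add: matrix_vector_mult_basis column_def inner_axis')
  also have "\<dots> = (T *v axis i 1) \<bullet> (M *v (T *v axis j 1))"
    by (metis dot_lmul_matrix matrix_vector_mul_assoc transpose_matrix_vector vector_transpose_matrix)
  finally show ?thesis by (simp add: bil_def matrix_vector_mult_basis)
qed

section \<open>The spectral theorem for real symmetric matrices\<close>

lemma symmetric_eigenvector_exists:
  fixes M :: "real^'n^'n" and S :: "(real^'n) set"
  assumes sym: "transpose M = M" and S: "subspace S" and inv: "\<And>x. x \<in> S \<Longrightarrow> M *v x \<in> S"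
    and nz: "u \<in> S" "u \<noteq> 0"
  obtains v l where "v \<in> S" "norm v = 1" "M *v v = l *\<^sub>R v"
proof -
  let ?K = "sphere 0 1 \<inter> S"
  have "compact ?K"
    using S closed_subspace compact_Int_closed compact_sphere by blast
  moreover have "u /\<^sub>R norm u \<in> ?K"
    using nz S by (auto simp: subspace_scale)
  moreover have "continuous_on ?K (\<lambda>x. bil M x x)"
    unfolding bil_def by (intro continuous_intros)
  ultimately obtain v where v: "v \<in> ?K" and vmax: "\<And>y. y \<in> ?K \<Longrightarrow> bil M y y \<le> bil M v v"
    using continuous_attains_sup[of ?K] by blast
  define l where "l = bil M v v"
  have le: "bil M x x \<le> l * (x \<bullet> x)" if "x \<in> S" for x
  proof (cases "x = 0")
    case False
    have "bil M (x /\<^sub>R norm x) (x /\<^sub>R norm x) \<le> l"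
      unfolding l_def using vmax[of "x /\<^sub>R norm x"] that False S by (auto simp: subspace_scale)
    then show ?thesis using False
      by (simp add: bil_simps field_simps power2_norm_eq_inner[symmetric] power2_eq_square)
  qed (simp add: bil_simps)
  \<comment> \<open>Here \<open>v\<close> maximises the quadratic form on the unit sphere of
    \<open>S\<close>, so the form is at most \<open>l\<close> times the squared norm on
    \<open>S\<close>. Testing this bound at \<open>v + t *\<^sub>R w\<close>, with \<open>w\<close>
    the residual of the eigenvector equation, gives a polynomial in \<open>t\<close> whose linear
    term is \<open>2 * t * (w \<bullet> w)\<close>; being nonnegative for all \<open>t\<close>, it
    forces \<open>w = 0\<close>.\<close>
  define w where "w = l *\<^sub>R v - M *v v"
  have wS: "w \<in> S" unfolding w_def using v S inv by (auto intro: subspace_diff subspace_scale)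
  have vv: "v \<bullet> v = 1" using v by (simp add: norm_eq_1)
  define K where "K = l * (w \<bullet> w) - bil M w w"
  have Kn: "K \<ge> 0" using le[OF wS] by (simp add: K_def)
  have quad: "0 \<le> 2 * t * (w \<bullet> w) + t\<^sup>2 * K" for t
  proof -
    have "bil M v w = bil M w v" using bil_commute[OF sym] .
    moreover have "w \<bullet> w = l * (v \<bullet> w) - bil M w v"
      by (subst (2) w_def) (simp add: bil_def inner_diff_right inner_commute)
    moreover have "v + t *\<^sub>R w \<in> S" using v wS S by (auto intro: subspace_add subspace_scale)
    from le[OF this] have "l + 2 * t * bil M v w + t\<^sup>2 * bil M w w
          \<le> l * (1 + 2 * t * (v \<bullet> w) + t\<^sup>2 * (w \<bullet> w))"
      using \<open>bil M v w = bil M w v\<close> vv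
      by (simp add: bil_simps inner_add_left inner_add_right inner_commute power2_eq_square
          l_def[symmetric] algebra_simps)
    moreover have "t * (w \<bullet> w) = t * (l * (v \<bullet> w)) - t * bil M w v"
      using calculation(2) by (simp add: right_diff_distrib)
    ultimately show ?thesis by (simp add: K_def algebra_simps)
  qed
  have "w \<bullet> w = 0"
  proof (rule ccontr)
    assume "w \<bullet> w \<noteq> 0"
    then have p: "w \<bullet> w > 0" by simp
    \<comment> \<open>The denominator is \<open>K + 1\<close> because \<open>K\<close> may be
      zero.\<close>
    define t where "t = - (w \<bullet> w) / (K + 1)"
    have "2 * t * (w \<bullet> w) + t\<^sup>2 * K = (w \<bullet> w)^2 / (K+1)^2 * (K - 2 * (K + 1))"
      using Kn unfolding t_def
      by (simp add: divide_simps power2_eq_square) (simp add: algebra_simps)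
    also have "\<dots> < 0" using p Kn by (intro mult_pos_neg) auto
    finally show False using quad[of t] by simp
  qed
  then have "M *v v = l *\<^sub>R v" by (simp add: w_def)
  with v that show thesis by (metis IntE mem_sphere_0)
qed

text \<open>Induction on the number of eigenvectors: by symmetry the orthogonal complement of those
  already found is invariant under \<open>M\<close>, and it is nonzero as long as fewer than
  \<open>CARD('n)\<close> have been found, so it contains a further one.\<close>

lemma orthonormal_eigenvectors:
  fixes M :: "real^'n^'n"
  assumes sym: "transpose M = M" and "k \<le> CARD('n)"
  shows "\<exists>B. finite B \<and> card B = k \<and> pairwise orthogonal B \<and>
    (\<forall>b\<in>B. norm b = 1 \<and> (\<exists>l. M *v b = l *\<^sub>R b))"
  using assms(2)
proof (induction k)
  case 0
  then show ?case by (intro exI[of _ "{}"]) auto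
next
  case (Suc k)
  then obtain B where B: "finite B" "card B = k" "pairwise orthogonal B"
    "\<And>b. b \<in> B \<Longrightarrow> norm b = 1" "\<And>b. b \<in> B \<Longrightarrow> \<exists>l. M *v b = l *\<^sub>R b"
    by auto
  define S where "S = {x. \<forall>b\<in>B. orthogonal b x}"
  have "dim B < DIM(real^'n)"
    using Suc.prems dim_le_card'[OF B(1)] B(2) by simp
  then obtain u where "u \<noteq> 0" "\<And>y. y \<in> span B \<Longrightarrow> orthogonal u y"
    using orthogonal_to_subspace_exists by blast
  then have u: "u \<in> S" by (auto simp: S_def orthogonal_commute span_base)
  have sub: "subspace S"
    unfolding S_def by (rule subspaceI) (auto simp: orthogonal_clauses)
  have inv: "M *v x \<in> S" if "x \<in> S" for x
    unfolding S_def
  proof safe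
    fix b assume b: "b \<in> B"
    then obtain l where l: "M *v b = l *\<^sub>R b" using B by blast
    have "b \<bullet> (M *v x) = x \<bullet> (M *v b)"
      using bil_commute[OF sym] unfolding bil_def by blast
    also have "\<dots> = 0" using that b l by (simp add: S_def orthogonal_def inner_commute)
    finally show "orthogonal b (M *v x)" by (simp add: orthogonal_def)
  qed
  obtain v l where v: "v \<in> S" "norm v = 1" "M *v v = l *\<^sub>R v"
    using symmetric_eigenvector_exists[OF sym sub inv u \<open>u \<noteq> 0\<close>] by metis
  have "v \<notin> B"
    using v by (auto simp: S_def orthogonal_def)
  then show ?case using B v
    by (intro exI[of _ "insert v B"]) (auto simp: pairwise_insert S_def orthogonal_commute)
qed

lemma spectral_decomposition:
  fixes M :: "real^'n^'n"
  assumes sym: "transpose M = M"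
  obtains P D where "orthogonal_matrix P" "\<And>i j. i \<noteq> j \<Longrightarrow> D $ i $ j = 0"
    "M = P ** D ** transpose P"
proof -
  obtain B where B: "finite B" "card B = CARD('n)" "pairwise orthogonal B"
    "\<And>b. b \<in> B \<Longrightarrow> norm b = 1" "\<And>b. b \<in> B \<Longrightarrow> \<exists>l. M *v b = l *\<^sub>R b"
    using orthonormal_eigenvectors[OF sym order_refl] by blast
  obtain f where f: "bij_betw f (UNIV::'n set) B"
    using B by (metis finite_class.finite_UNIV finite_same_card_bij)
  then have fB: "f i \<in> B" for i by (auto simp: bij_betw_def)
  define P where "P = (\<chi> i j. f j $ i)"
  have col: "column j P = f j" for j by (simp add: P_def column_def)
  have orth: "orthogonal_matrix P"
    unfolding orthogonal_matrix_orthonormal_columns col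
    using f B(3,4) fB by (metis bij_betw_imp_inj_on injD pairwiseD)
  then have PP: "P ** transpose P = mat 1" "transpose P ** P = mat 1"
    by (simp_all add: orthogonal_matrix_def)
  define D where "D = transpose P ** M ** P"
  have "D $ i $ j = 0" if "i \<noteq> j" for i j
  proof -
    obtain l where "M *v f j = l *\<^sub>R f j" using B fB by blast
    moreover have "orthogonal (f i) (f j)"
      using f B(3) fB that by (metis bij_betw_imp_inj_on injD pairwiseD)
    ultimately show ?thesis
      by (simp add: D_def matrix_congruence_nth col bil_def orthogonal_def)
  qed
  moreover have "M = P ** D ** transpose P"
    using PP unfolding D_def
    by (metis matrix_mul_assoc matrix_mul_lid matrix_mul_rid)
  ultimately show thesis using orth that by blast
qed

section \<open>The law of inertia and the evaluation of \<open>pos_eig\<close>\<close>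

lemma bil_span_orthogonal:
  fixes f :: "'i \<Rightarrow> real^'n"
  assumes "finite I" "\<And>i j. i \<noteq> j \<Longrightarrow> bil M (f i) (f j) = 0" "x \<in> span (f ` I)" "inj_on f I"
  obtains c where "x = (\<Sum>i\<in>I. c i *\<^sub>R f i)" "bil M x x = (\<Sum>i\<in>I. (c i)\<^sup>2 * bil M (f i) (f i))"
proof -
  have "x \<in> range (\<lambda>u. \<Sum>v\<in>f ` I. u v *\<^sub>R v)"
    using assms span_finite by blast
  then obtain u where "x = (\<Sum>v\<in>f ` I. u v *\<^sub>R v)" by auto
  then have x: "x = (\<Sum>i\<in>I. u (f i) *\<^sub>R f i)"
    using assms(4) by (simp add: sum.reindex)
  have "bil M x x = (\<Sum>i\<in>I. \<Sum>j\<in>I. u (f i) * u (f j) * bil M (f j) (f i))"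
    unfolding x bil_sum_left bil_sum_right by (simp add: bil_simps mult_ac)
  also have "\<dots> = (\<Sum>i\<in>I. \<Sum>j\<in>I. if i = j then (u (f i))\<^sup>2 * bil M (f i) (f i) else 0)"
    using assms(2) by (intro sum.cong) (auto simp: power2_eq_square)
  also have "\<dots> = (\<Sum>i\<in>I. (u (f i))\<^sup>2 * bil M (f i) (f i))"
    using assms(1) by simp
  finally show thesis using x that[of "\<lambda>i. u (f i)"] by simp
qed

text \<open>The form is positive on nonzero vectors of the span of the positive \<open>f i\<close>
  and nonpositive on the span of the remaining \<open>g i\<close>. These two spans therefore meet
  only in 0, and their dimensions add up to at most that of the space. Exchanging \<open>f\<close>
  and \<open>g\<close> gives equality.\<close>

lemma inertia_le:
  fixes f g :: "'n::finite \<Rightarrow> real^'n"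
  assumes f: "inj f" "independent (range f)" "\<And>i j. i \<noteq> j \<Longrightarrow> bil M (f i) (f j) = 0"
    and g: "inj g" "independent (range g)" "\<And>i j. i \<noteq> j \<Longrightarrow> bil M (g i) (g j) = 0"
  shows "card {i. bil M (f i) (f i) > 0} \<le> card {i. bil M (g i) (g i) > 0}"
proof -
  let ?I = "{i. bil M (f i) (f i) > 0}" and ?J = "{i. \<not> bil M (g i) (g i) > 0}"
  have inj: "inj_on f ?I" "inj_on g ?J" using f(1) g(1) inj_on_subset by blast+
  have "independent (f ` ?I)" by (rule independent_mono[OF f(2)]) blast
  then have dU: "dim (span (f ` ?I)) = card ?I"
    by (simp add: dim_eq_card_independent card_image[OF inj(1)])
  have "independent (g ` ?J)" by (rule independent_mono[OF g(2)]) blast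
  then have dV: "dim (span (g ` ?J)) = card ?J"
    by (simp add: dim_eq_card_independent card_image[OF inj(2)])
  have "span (f ` ?I) \<inter> span (g ` ?J) \<subseteq> {0}"
  proof
    fix x assume x: "x \<in> span (f ` ?I) \<inter> span (g ` ?J)"
    obtain c where c: "x = (\<Sum>i\<in>?I. c i *\<^sub>R f i)" "bil M x x = (\<Sum>i\<in>?I. (c i)\<^sup>2 * bil M (f i) (f i))"
      using bil_span_orthogonal[of ?I M f x] f inj(1) x by auto
    obtain d where d: "bil M x x = (\<Sum>i\<in>?J. (d i)\<^sup>2 * bil M (g i) (g i))"
      using bil_span_orthogonal[of ?J M g x] g inj(2) x by auto
    have "bil M x x \<le> 0" unfolding d by (intro sum_nonpos) (auto intro: mult_nonneg_nonpos)
    then have "(\<Sum>i\<in>?I. (c i)\<^sup>2 * bil M (f i) (f i)) = 0"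
      unfolding c(2) by (intro antisym sum_nonneg) auto
    then have "\<forall>i\<in>?I. (c i)\<^sup>2 * bil M (f i) (f i) = 0"
      by (subst (asm) sum_nonneg_eq_0_iff) auto
    then have "\<forall>i\<in>?I. c i = 0" by auto
    then show "x \<in> {0}" unfolding c(1) by simp
  qed
  then have "dim (span (f ` ?I) \<inter> span (g ` ?J)) = 0" by (simp add: dim_eq_0)
  with dim_sums_Int[OF subspace_span subspace_span, of "f ` ?I" "g ` ?J"]
  have "card ?I + card ?J \<le> CARD('n)"
    using dU dV dim_subset_UNIV[of "{x + y |x y. x \<in> span (f ` ?I) \<and> y \<in> span (g ` ?J)}"]
    by simp
  moreover have "card ?J + card {i. bil M (g i) (g i) > 0} = CARD('n)"
  proof -
    have "UNIV = ?J \<union> {i. bil M (g i) (g i) > 0}" by auto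
    then have "CARD('n) = card (?J \<union> {i. bil M (g i) (g i) > 0})" by simp
    also have "\<dots> = card ?J + card {i. bil M (g i) (g i) > 0}"
      by (intro card_Un_disjoint) auto
    finally show ?thesis by simp
  qed
  ultimately show ?thesis by linarith
qed

lemma bil_orthogonal_independent:
  fixes f :: "'n::finite \<Rightarrow> real^'m"
  assumes orth: "\<And>i j. i \<noteq> j \<Longrightarrow> bil M (f i) (f j) = 0" and nz: "\<And>i. bil M (f i) (f i) \<noteq> 0"
  shows "inj f" "independent (range f)"
proof -
  show inj: "inj f" using assms by (metis injI)
  show "independent (range f)"
  proof (rule independent_if_scalars_zero)
    fix u x assume sum: "(\<Sum>x\<in>range f. u x *\<^sub>R x) = 0" and "x \<in> range f"
    then obtain i where i: "x = f i" by auto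
    have "(\<Sum>j\<in>UNIV. u (f j) *\<^sub>R f j) = 0" using sum inj by (simp add: sum.reindex)
    then have "0 = bil M (f i) (\<Sum>j\<in>UNIV. u (f j) *\<^sub>R f j)" by (simp add: bil_simps)
    also have "\<dots> = (\<Sum>j\<in>UNIV. if i = j then u (f j) * bil M (f i) (f i) else 0)"
      unfolding bil_sum_right using orth by (intro sum.cong) (auto simp: bil_simps)
    also have "\<dots> = u (f i) * bil M (f i) (f i)" by simp
    finally show "u x = 0" using nz i by simp
  qed simp
qed

text \<open>The definite description in \<open>pos_eig\<close> is resolved here: a diagonalisation
  exists by the spectral theorem, and by inertia each one yields the same count as \<open>f\<close>.
  Positive eigenvalues can thus be counted on any orthogonal basis without isotropic vectors, and no
  eigenvalue has to be computed.\<close>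

lemma pos_eig_eq:
  fixes f :: "4 \<Rightarrow> real^4"
  assumes sym: "transpose M = M"
    and orth: "\<And>i j. i \<noteq> j \<Longrightarrow> bil M (f i) (f j) = 0" and nz: "\<And>i. bil M (f i) (f i) \<noteq> 0"
  shows "pos_eig M = card {i. bil M (f i) (f i) > 0}"
proof -
  have *: "card {i. D $ i $ i > 0} = card {i. bil M (f i) (f i) > 0}"
    if P: "orthogonal_matrix P" and D: "\<forall>i j. i \<noteq> j \<longrightarrow> D $ i $ j = 0"
      and M: "M = P ** D ** transpose P" for P D :: "real^4^4"
  proof -
    have PP: "transpose P ** P = mat 1" using P by (simp add: orthogonal_matrix_def)
    have "D = transpose P ** M ** P"
      unfolding M by (metis PP matrix_mul_assoc matrix_mul_lid matrix_mul_rid)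
    then have Dij: "D $ i $ j = bil M (column i P) (column j P)" for i j
      by (simp add: matrix_congruence_nth)
    \<comment> \<open>A column of \<open>P\<close> might be isotropic for \<open>M\<close>, so
      independence of the columns is drawn from the identity form instead.\<close>
    have I: "bil (mat 1) (column i P) (column j P) = (if i = j then 1 else 0)" for i j
    proof -
      have "bil (mat 1) (column i P) (column j P) = (transpose P ** P) $ i $ j"
        by (simp add: matrix_congruence_nth[symmetric] matrix_mul_rid)
      then show ?thesis unfolding PP by (simp add: mat_def)
    qed
    have col: "inj (\<lambda>i. column i P)" "independent (range (\<lambda>i. column i P))"
      using bil_orthogonal_independent[of "mat 1" "\<lambda>i. column i P"] I by auto
    have "bil M (column i P) (column j P) = 0" if "i \<noteq> j" for i j
      using D that by (simp add: Dij[symmetric])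
    with col show ?thesis unfolding Dij
      using bil_orthogonal_independent[of M f, OF orth nz] orth
      by (intro antisym inertia_le) auto
  qed
  obtain P D where PD: "orthogonal_matrix P" "\<And>i j. i \<noteq> j \<Longrightarrow> D $ i $ j = 0"
    "M = P ** D ** transpose P" using spectral_decomposition[OF sym] by blast
  show ?thesis
    unfolding pos_eig_def
  proof (rule the_equality)
    show "\<exists>P D. orthogonal_matrix P \<and> (\<forall>i j. i \<noteq> j \<longrightarrow> D $ i $ j = 0) \<and> M = P ** D ** transpose P
        \<and> card {i. bil M (f i) (f i) > 0} = card {i. D $ i $ i > 0}"
      using PD *[of P D] by (intro exI[of _ P] exI[of _ D]) auto
  qed (use * in auto)
qed

subsection \<open>Normal form of the pencil\<close>

lemma det_block4:
  fixes M :: "real^4^4"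
  assumes "M$1$2 = 0" "M$1$3 = 0" "M$1$4 = 0" "M$2$1 = 0" "M$2$3 = 0" "M$2$4 = 0"
  shows "det M = M$1$1 * M$2$2 * (M$3$3 * M$4$4 - M$3$4 * M$4$3)"
proof -
  have f1234: "finite {2::4, 3, 4}" "1 \<notin> {2::4, 3, 4}"
    and f234: "finite {3::4, 4}" "2 \<notin> {3::4, 4}"
    and f34: "finite {4::4}" "3 \<notin> {4::4}" by auto
  show ?thesis
    unfolding det_def UNIV_4
    unfolding sum_over_permutations_insert[OF f1234]
    unfolding sum_over_permutations_insert[OF f234]
    unfolding sum_over_permutations_insert[OF f34]
    unfolding permutes_sing
    using assms
    by (simp add: sign_swap_id permutation_swap_id permutation_compose sign_compose sign_id
        swap_id_eq algebra_simps)
qed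

lemma tendsto_det:
  fixes N :: "real^'n^'n"
  assumes "\<And>i j. ((\<lambda>x. M x $ i $ j) \<longlongrightarrow> N $ i $ j) F"
  shows "((\<lambda>x. det (M x)) \<longlongrightarrow> det N) F"
  unfolding det_def by (intro tendsto_intros assms)

lemma det_scaleR:
  fixes M :: "real^'n^'n"
  shows "det (s *\<^sub>R M) = s ^ CARD('n) * det M"
proof -
  have "s *\<^sub>R M = (\<chi> i. s *s M $ i)" by (simp add: vec_eq_iff)
  then show ?thesis using det_rows_mul[of "\<lambda>_. s" "\<lambda>i. M $ i"] by (simp add: vec_lambda_eta)
qed

text \<open>For nonzero \<open>s\<close>, the determinant of \<open>A - s *\<^sub>R B\<close> is
  \<open>s ^ 4\<close> times that of the pencil at \<open>1 / s\<close>; letting \<open>s\<close>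
  tend to 0 leaves the leading coefficient. This shows that \<open>A\<close> is nonsingular.\<close>

lemma det_pencil_leading_coeff:
  fixes A B :: "real^4^4"
  assumes "\<And>t. det (t *\<^sub>R A - B) = c * (t - l)^2 * ((t - a)^2 + b^2)"
  shows "det A = c"
proof -
  let ?g = "\<lambda>s. c * (1 - s * l)^2 * ((1 - s * a)^2 + (s * b)^2)"
  have "((\<lambda>s. det (A - s *\<^sub>R B)) \<longlongrightarrow> det A) (at 0)"
    by (rule tendsto_det) (auto intro!: tendsto_eq_intros)
  moreover have "det (A - s *\<^sub>R B) = ?g s" if "s \<noteq> 0" for s
  proof -
    have "A - s *\<^sub>R B = s *\<^sub>R ((1 / s) *\<^sub>R A - B)"
      using that by (simp add: scaleR_diff_right)
    also have "det \<dots> = s ^ 4 * det ((1 / s) *\<^sub>R A - B)"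
      by (simp add: det_scaleR del: scaleR_scaleR)
    also have "\<dots> = c * (s * (1 / s - l))^2 * ((s * (1 / s - a))^2 + (s * b)^2)"
      unfolding assms by algebra
    also have "\<dots> = ?g s" using that by (simp add: right_diff_distrib)
    finally show ?thesis .
  qed
  then have "((\<lambda>s. det (A - s *\<^sub>R B)) \<longlongrightarrow> c) (at 0) \<longleftrightarrow> (?g \<longlongrightarrow> c) (at 0)"
    by (intro tendsto_cong) (auto simp: eventually_at_filter)
  moreover have "(?g \<longlongrightarrow> c) (at 0)"
    by (auto intro!: tendsto_eq_intros)
  ultimately show ?thesis using tendsto_unique[OF at_neq_bot] by blast
qed

section \<open>Ordered bases of real 4-space and their elementary changes\<close>

definition frame :: "real^4 \<Rightarrow> real^4 \<Rightarrow> real^4 \<Rightarrow> real^4 \<Rightarrow> bool" where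
  "frame x y z w \<longleftrightarrow> (\<forall>a b c d. a *\<^sub>R x + b *\<^sub>R y + c *\<^sub>R z + d *\<^sub>R w = 0
      \<longrightarrow> a = 0 \<and> b = 0 \<and> c = 0 \<and> d = 0)"

definition cols4 :: "real^4 \<Rightarrow> real^4 \<Rightarrow> real^4 \<Rightarrow> real^4 \<Rightarrow> real^4^4" where
  "cols4 x y z w = (\<chi> i j. (if j = 1 then x else if j = 2 then y else if j = 3 then z else w) $ i)"

lemma column_cols4 [simp]:
  "column 1 (cols4 x y z w) = x" "column 2 (cols4 x y z w) = y"
  "column 3 (cols4 x y z w) = z" "column 4 (cols4 x y z w) = w"
  by (simp_all add: cols4_def column_def vec_eq_iff)

lemma frame_det:
  assumes "frame x y z w"
  shows "det (cols4 x y z w) \<noteq> 0"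
proof -
  have "(\<Sum>i\<in>UNIV. c i *s column i (cols4 x y z w)) = 0 \<longrightarrow> (\<forall>i. c i = 0)" for c
    using assms unfolding frame_def sum_4 forall_4 by (simp add: scalar_mult_eq_scaleR)
  then show ?thesis
    unfolding invertible_det_nz[symmetric] invertible_left_inverse
      matrix_left_invertible_independent_columns by blast
qed

lemma frame_swap12: "frame x y z w \<Longrightarrow> frame y x z w"
  unfolding frame_def
proof (intro allI impI)
  fix a b c d
  assume fr: "\<forall>a b c d. a *\<^sub>R x + b *\<^sub>R y + c *\<^sub>R z + d *\<^sub>R w = 0
      \<longrightarrow> a = 0 \<and> b = 0 \<and> c = 0 \<and> d = 0"
    and "a *\<^sub>R y + b *\<^sub>R x + c *\<^sub>R z + d *\<^sub>R w = 0"
  then have "b *\<^sub>R x + a *\<^sub>R y + c *\<^sub>R z + d *\<^sub>R w = 0" by (simp add: add.commute)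
  then show "a = 0 \<and> b = 0 \<and> c = 0 \<and> d = 0" using fr by blast
qed

lemma frame_add_multiple:
  assumes "frame x y z w" shows "frame x (y + t *\<^sub>R x) z w"
  unfolding frame_def
proof (intro allI impI)
  fix a b c d assume "a *\<^sub>R x + b *\<^sub>R (y + t *\<^sub>R x) + c *\<^sub>R z + d *\<^sub>R w = 0"
  then have "(a + b * t) *\<^sub>R x + b *\<^sub>R y + c *\<^sub>R z + d *\<^sub>R w = 0"
    by (simp add: algebra_simps)
  then show "a = 0 \<and> b = 0 \<and> c = 0 \<and> d = 0"
    using assms unfolding frame_def by (metis add_cancel_left_right mult_zero_left)
qed

lemma frame_change34:
  assumes "frame x y z w" "p * s - q * r \<noteq> 0"
  shows "frame x y (p *\<^sub>R z + q *\<^sub>R w + t *\<^sub>R x + u *\<^sub>R y) (r *\<^sub>R z + s *\<^sub>R w + v *\<^sub>R x + k *\<^sub>R y)"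
  unfolding frame_def
proof (intro allI impI)
  fix a b c d assume "a *\<^sub>R x + b *\<^sub>R y + c *\<^sub>R (p *\<^sub>R z + q *\<^sub>R w + t *\<^sub>R x + u *\<^sub>R y)
    + d *\<^sub>R (r *\<^sub>R z + s *\<^sub>R w + v *\<^sub>R x + k *\<^sub>R y) = 0"
  then have "(a + c * t + d * v) *\<^sub>R x + (b + c * u + d * k) *\<^sub>R y
      + (c * p + d * r) *\<^sub>R z + (c * q + d * s) *\<^sub>R w = 0"
    by (simp add: algebra_simps)
  then have 0: "a + c * t + d * v = 0" "b + c * u + d * k = 0" "c * p + d * r = 0" "c * q + d * s = 0"
    using assms(1) unfolding frame_def by blast+
  have "c * (p * s - q * r) = (c * p + d * r) * s - (c * q + d * s) * r"
    "d * (p * s - q * r) = (c * q + d * s) * p - (c * p + d * r) * q"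
    by (simp_all add: algebra_simps)
  then have "c = 0" "d = 0" using assms(2) unfolding 0 by simp_all
  then show "a = 0 \<and> b = 0 \<and> c = 0 \<and> d = 0" using 0 by simp
qed

text \<open>A basis of the kernel is extended to a basis of the whole space; the two added vectors
  become \<open>z\<close> and \<open>w\<close>.\<close>

lemma frame_of_kernel:
  fixes C :: "real^4^4"
  assumes "dim {v. C *v v = 0} = 2"
  obtains x y z w where "frame x y z w" "C *v x = 0" "C *v y = 0"
proof -
  obtain K where K: "K \<subseteq> {v. C *v v = 0}" "independent K" "card K = 2"
    using basis_exists assms by metis
  obtain x y where xy: "K = {x, y}" "x \<noteq> y" using K(3) by (auto simp: card_2_iff)
  obtain B where B: "K \<subseteq> B" "B \<subseteq> UNIV" "independent B" "UNIV \<subseteq> span B"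
    by (rule maximal_independent_subset_extend[OF subset_UNIV K(2)])
  have finB: "finite B" using B(3) independent_imp_finite by blast
  have "card B = 4" using B(3,4) dim_eq_card[of B UNIV] by auto
  then have "card (B - K) = 2" using B(1) K(3) finB by (simp add: card_Diff_subset finite_subset)
  then obtain z w where zw: "B - K = {z, w}" "z \<noteq> w" by (auto simp: card_2_iff)
  have Beq: "B = {x, y, z, w}" using zw xy B(1) by blast
  have ne: "x \<noteq> z" "x \<noteq> w" "y \<noteq> z" "y \<noteq> w" using zw xy by blast+
  have "frame x y z w"
    unfolding frame_def
  proof (intro allI impI)
    fix a b c d assume 0: "a *\<^sub>R x + b *\<^sub>R y + c *\<^sub>R z + d *\<^sub>R w = 0"
    \<comment> \<open>The four coefficients become one function on the set \<open>B\<close>; no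
      value is overwritten because the four vectors are distinct.\<close>
    define u where "u v = (if v = x then a else if v = y then b else if v = z then c else d)" for v
    have "(\<Sum>v\<in>B. u v *\<^sub>R v) = 0"
      unfolding Beq using ne xy(2) zw(2) 0 by (simp add: u_def add.assoc)
    then have "\<forall>v\<in>B. u v = 0" using B(3) unfolding independent_explicit by blast
    then have "u x = 0" "u y = 0" "u z = 0" "u w = 0" unfolding Beq by auto
    then show "a = 0 \<and> b = 0 \<and> c = 0 \<and> d = 0" using ne xy(2) zw(2) by (simp add: u_def)
  qed
  then show thesis using that K(1) xy by auto
qed

text \<open>The values at 1, -1 and 2 determine a quadratic. The point 0 has to be avoided because
  the identities compared later arise by cancelling \<open>s\<^sup>2\<close>.\<close>

lemma quadratic_coeffs_eq:
  fixes x0 :: real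
  assumes "\<And>s. s \<noteq> 0 \<Longrightarrow> x0 + x1 * s + x2 * s\<^sup>2 = y0 + y1 * s + y2 * s\<^sup>2"
  shows "x0 = y0" "x1 = y1" "x2 = y2"
proof -
  have *: "x0 + x1 + x2 = y0 + y1 + y2" "x0 - x1 + x2 = y0 - y1 + y2"
    "x0 + 2 * x1 + 4 * x2 = y0 + 2 * y1 + 4 * y2"
    using assms[of 1] assms[of "-1"] assms[of 2] by simp_all
  show "x0 = y0" "x1 = y1" "x2 = y2" using * by linarith+
qed

text \<open>The binary form with coefficients \<open>\<alpha>\<close>, \<open>2 * \<beta>\<close>,
  \<open>\<gamma>\<close> is indefinite, so it vanishes on two different real lines. For
  \<open>\<alpha> \<noteq> 0\<close> they are spanned by \<open>(- \<beta> + D, \<alpha>)\<close>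
  and \<open>(- \<beta> - D, \<alpha>)\<close>, with \<open>D\<close> the root of
  \<open>\<beta>\<^sup>2 - \<alpha> * \<gamma>\<close>.\<close>

lemma isotropic_pair:
  fixes \<alpha> \<beta> \<gamma> :: real
  assumes "\<alpha> * \<gamma> - \<beta>\<^sup>2 < 0"
  obtains x y z w where "x * w - y * z \<noteq> 0" "\<alpha> * x\<^sup>2 + 2 * \<beta> * x * y + \<gamma> * y\<^sup>2 = 0"
    "\<alpha> * z\<^sup>2 + 2 * \<beta> * z * w + \<gamma> * w\<^sup>2 = 0"
proof (cases "\<alpha> = 0")
  case True
  then have "\<beta> \<noteq> 0" using assms by auto
  \<comment> \<open>The isotropic vectors are \<open>(1, 0)\<close> and
    \<open>(\<gamma>, - 2 * \<beta>)\<close>.\<close>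
  with True show thesis
    by (intro that[of 1 "- 2 * \<beta>" 0 \<gamma>]) (auto simp: power2_eq_square)
next
  case False
  define D where "D = sqrt (\<beta>\<^sup>2 - \<alpha> * \<gamma>)"
  have D: "D > 0" "D\<^sup>2 = \<beta>\<^sup>2 - \<alpha> * \<gamma>" using assms by (simp_all add: D_def)
  have *: "\<alpha> * (- \<beta> + e)\<^sup>2 + 2 * \<beta> * (- \<beta> + e) * \<alpha> + \<gamma> * \<alpha>\<^sup>2 = 0" if "e\<^sup>2 = D\<^sup>2" for e
  proof -
    have "\<alpha> * (- \<beta> + e)\<^sup>2 + 2 * \<beta> * (- \<beta> + e) * \<alpha> + \<gamma> * \<alpha>\<^sup>2 = \<alpha> * (e\<^sup>2 - (\<beta>\<^sup>2 - \<alpha> * \<gamma>))"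
      by (simp add: power2_eq_square algebra_simps)
    then show ?thesis using that D by simp
  qed
  show thesis
  proof (rule that)
    show "(- \<beta> + D) * \<alpha> - \<alpha> * (- \<beta> + - D) \<noteq> 0" using False D by (simp add: algebra_simps)
  qed (use *[of D] *[of "- D"] in auto)
qed

section \<open>Splitting the pencil along the kernel of \<open>C\<close>\<close>

context
  fixes A C :: "real^4^4" and c d b :: real
  assumes symA: "transpose A = A" and symC: "transpose C = C"
    and c: "c \<noteq> 0" and b: "b \<noteq> 0"
    and det_pencil: "\<And>s. det (s *\<^sub>R A + C) = c * s\<^sup>2 * ((s - d)\<^sup>2 + b\<^sup>2)"
begin

lemma det_pencil_frame:
  "det (transpose T ** (s *\<^sub>R A + C) ** T) = (det T)\<^sup>2 * (c * s\<^sup>2 * ((s - d)\<^sup>2 + b\<^sup>2))"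
  by (simp add: det_mul det_pencil power2_eq_square)

lemma bil_kernel: "C *v x = 0 \<Longrightarrow> bil C x y = 0" "C *v x = 0 \<Longrightarrow> bil C y x = 0"
proof -
  show "C *v x = 0 \<Longrightarrow> bil C y x = 0" by (simp add: bil_def)
  then show "C *v x = 0 \<Longrightarrow> bil C x y = 0" using bil_commute[OF symC] by metis
qed

text \<open>Otherwise \<open>s\<^sup>3\<close> would divide the determinant: dividing the first two rows of the
  transformed pencil by \<open>s\<close> leaves a matrix whose first column vanishes at \<open>s = 0\<close>.\<close>

lemma kernel_nondegenerate:
  assumes fr: "frame x y z w" and ker: "C *v x = 0" "C *v y = 0" and "bil A x x = 0"
  shows "bil A x y \<noteq> 0"
proof
  assume xy: "bil A x y = 0"
  define T where "T = cols4 x y z w"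
  define N where "N s = (\<chi> i j. if i = 1 \<or> i = 2 then bil A (column i T) (column j T)
      else s * bil A (column i T) (column j T) + bil C (column i T) (column j T))" for s
  have dT: "det T \<noteq> 0" using frame_det[OF fr] by (simp add: T_def)
  have "transpose T ** (s *\<^sub>R A + C) ** T = (\<chi> i. (if i = 1 \<or> i = 2 then s else 1) *s N s $ i)" for s
    using ker
    by (auto simp: vec_eq_iff matrix_congruence_nth bil_matrix_add bil_matrix_scale N_def T_def
        bil_kernel)
  then have "det (transpose T ** (s *\<^sub>R A + C) ** T) =
      (\<Prod>i\<in>UNIV. if i = (1::4) \<or> i = 2 then s else 1) * det (\<chi> i. N s $ i)" for s
    by (simp only: det_rows_mul)
  moreover have "(\<Prod>i\<in>UNIV. if i = (1::4) \<or> i = 2 then s else 1) = s\<^sup>2" for s :: real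
    unfolding UNIV_4 by (simp add: power2_eq_square)
  ultimately have N_det: "(det T)\<^sup>2 * (c * s\<^sup>2 * ((s - d)\<^sup>2 + b\<^sup>2)) = s\<^sup>2 * det (N s)" for s
    unfolding det_pencil_frame vec_lambda_eta by simp
  have s2: "s\<^sup>2 * det (N s) = s\<^sup>2 * ((det T)\<^sup>2 * c * ((s - d)\<^sup>2 + b\<^sup>2))" for s
    using N_det[of s] by (simp only: mult_ac)
  then have eq: "det (N s) = (det T)\<^sup>2 * c * ((s - d)\<^sup>2 + b\<^sup>2)" if "s \<noteq> 0" for s
  proof -
    have "s\<^sup>2 \<noteq> 0" using that by simp
    then show ?thesis using s2[of s] mult_left_cancel by blast
  qed
  have "N 0 $ i $ 1 = 0" for i
    using exhaust_4[of i] xy assms(4) ker bil_commute[OF symA, of y x]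
    by (auto simp: N_def T_def bil_kernel)
  then have "column 1 (N 0) = 0" by (simp add: column_def vec_eq_iff)
  then have "det (N 0) = 0" by (rule det_zero_column)
  \<comment> \<open>The identity \<open>eq\<close> says nothing at 0, so \<open>det (N 0)\<close> is
    reached as a limit.\<close>
  moreover have "((\<lambda>s. det (N s)) \<longlongrightarrow> det (N 0)) (at 0)"
  proof (rule tendsto_det)
    have "((\<lambda>s. if P then u else s * p + q) \<longlongrightarrow> (if P then u else 0 * p + q)) (at 0)"
      for P and u p q :: real
      by (cases P; simp only: if_True if_False; intro tendsto_intros)
    then show "((\<lambda>s. N s $ i $ j) \<longlongrightarrow> N 0 $ i $ j) (at 0)" for i j
      unfolding N_def vec_lambda_beta .
  qed
  moreover have "((\<lambda>s. det (N s)) \<longlongrightarrow> (det T)\<^sup>2 * c * (d\<^sup>2 + b\<^sup>2)) (at 0) \<longleftrightarrow>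
      ((\<lambda>s. (det T)\<^sup>2 * c * ((s - d)\<^sup>2 + b\<^sup>2)) \<longlongrightarrow> (det T)\<^sup>2 * c * (d\<^sup>2 + b\<^sup>2)) (at 0)"
    using eq by (intro tendsto_cong) (auto simp: eventually_at_filter)
  moreover have "((\<lambda>s. (det T)\<^sup>2 * c * ((s - d)\<^sup>2 + b\<^sup>2)) \<longlongrightarrow> (det T)\<^sup>2 * c * (d\<^sup>2 + b\<^sup>2)) (at 0)"
    by (auto intro!: tendsto_eq_intros)
  ultimately have "(det T)\<^sup>2 * c * (d\<^sup>2 + b\<^sup>2) = 0" by (metis tendsto_unique at_neq_bot)
  moreover have "d\<^sup>2 + b\<^sup>2 > 0" using b by (simp add: sum_power2_gt_zero_iff)
  ultimately show False using dT c by simp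
qed

text \<open>In this basis the matrix of the pencil is block diagonal, and the kernel block has
  determinant \<open>s\<^sup>2\<close> times a nonzero constant. What remains for the block of
  \<open>z\<close> and \<open>w\<close> is a multiple \<open>k\<close> of a quadratic that is
  positive everywhere since \<open>b \<noteq> 0\<close>.\<close>

lemma complement_negative:
  assumes fr: "frame x y z w" and ker: "C *v x = 0" "C *v y = 0"
    and orth: "bil A x y = 0" "bil A x z = 0" "bil A x w = 0" "bil A y z = 0" "bil A y w = 0"
    and nz: "bil A x x \<noteq> 0" "bil A y y \<noteq> 0"
  obtains k where "k < 0" "\<And>s. (s * bil A z z + bil C z z) * (s * bil A w w + bil C w w)
     - (s * bil A z w + bil C z w)\<^sup>2 = k * ((s - d)\<^sup>2 + b\<^sup>2)" "k = bil A z z * bil A w w - (bil A z w)\<^sup>2"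
proof -
  define T where "T = cols4 x y z w"
  have dT: "det T \<noteq> 0" using frame_det[OF fr] by (simp add: T_def)
  define p q r where pqr: "p = bil A z z" "q = bil A z w" "r = bil A w w"
  define \<alpha> \<beta> \<gamma> where abc: "\<alpha> = bil C z z" "\<beta> = bil C z w" "\<gamma> = bil C w w"
  define e where "e = bil A x x * bil A y y"
  define k where "k = (det T)\<^sup>2 * c / e"
  have e: "e \<noteq> 0" using nz by (simp add: e_def)
  have k: "k \<noteq> 0" using dT c e by (simp add: k_def)
  let ?N = "\<lambda>s. transpose T ** (s *\<^sub>R A + C) ** T"
  have N: "det (?N s) = s * bil A x x * (s * bil A y y) * ((s * p + \<alpha>) * (s * r + \<gamma>) - (s * q + \<beta>)\<^sup>2)" for s
    using ker orth
    by (subst det_block4)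
      (simp_all add: matrix_congruence_nth bil_matrix_add bil_matrix_scale T_def bil_kernel pqr abc
        power2_eq_square bil_commute[OF symA, of y x] bil_commute[OF symA, of w z] bil_commute[OF symC, of w z])
  have Q: "(s * p + \<alpha>) * (s * r + \<gamma>) - (s * q + \<beta>)\<^sup>2 = k * ((s - d)\<^sup>2 + b\<^sup>2)" if "s \<noteq> 0" for s
  proof -
    have "s\<^sup>2 * (e * ((s * p + \<alpha>) * (s * r + \<gamma>) - (s * q + \<beta>)\<^sup>2)) = s\<^sup>2 * ((det T)\<^sup>2 * c * ((s - d)\<^sup>2 + b\<^sup>2))"
      using N[of s, unfolded det_pencil_frame, symmetric] by (simp add: e_def power2_eq_square mult_ac)
    then have "e * ((s * p + \<alpha>) * (s * r + \<gamma>) - (s * q + \<beta>)\<^sup>2) = (det T)\<^sup>2 * c * ((s - d)\<^sup>2 + b\<^sup>2)"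
      using that by simp
    then show ?thesis using e by (simp add: k_def field_simps)
  qed
  have "(\<alpha> * \<gamma> - \<beta>\<^sup>2) + (p * \<gamma> + \<alpha> * r - 2 * q * \<beta>) * s + (p * r - q\<^sup>2) * s\<^sup>2
      = k * (d\<^sup>2 + b\<^sup>2) + (- 2 * k * d) * s + k * s\<^sup>2" if "s \<noteq> 0" for s
    using Q[OF that] by (simp add: power2_eq_square algebra_simps)
  note co = quadratic_coeffs_eq[OF this]
  \<comment> \<open>Comparing constant coefficients recovers the value at \<open>s = 0\<close>,
    which the division by \<open>s\<^sup>2\<close> had excluded.\<close>
  have Q: "(s * p + \<alpha>) * (s * r + \<gamma>) - (s * q + \<beta>)\<^sup>2 = k * ((s - d)\<^sup>2 + b\<^sup>2)" for s
    using Q[of s] co(1) by (cases "s = 0") auto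
  \<comment> \<open>If \<open>p \<noteq> 0\<close>, the choice \<open>s = - \<alpha> / p\<close>
    annihilates a diagonal entry, so the block determinant is minus a square there. If
    \<open>p = 0\<close>, the leading coefficient \<open>k = p * r - q\<^sup>2\<close> is itself
    minus a square.\<close>
  have "k \<le> 0"
  proof (cases "p = 0")
    case False
    have pos: "(- \<alpha> / p - d)\<^sup>2 + b\<^sup>2 > 0" using b by (simp add: sum_power2_gt_zero_iff)
    have "k * ((- \<alpha> / p - d)\<^sup>2 + b\<^sup>2) \<le> 0"
      using Q[of "- \<alpha> / p", symmetric] False by simp
    then show ?thesis using pos by (simp add: mult_le_0_iff)
  qed (use co(3) in auto)
  then show thesis using k Q co(3) by (intro that[of k]) (auto simp: pqr abc)
qed

text \<open>Gram-Schmidt with respect to \<open>A\<close> diagonalises the kernel and moves the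
  other two vectors into its \<open>A\<close>-orthogonal complement. A change of basis inside the
  complement then makes both of them isotropic for \<open>C\<close>.\<close>

lemma pencil_normal_form:
  assumes dimK: "dim {v. C *v v = 0} = 2"
  obtains x y z w where "C *v x = 0" "C *v y = 0"
    "bil A x y = 0" "bil A x z = 0" "bil A x w = 0" "bil A y z = 0" "bil A y w = 0"
    "bil A x x \<noteq> 0" "bil A y y \<noteq> 0" "bil C z z = 0" "bil C w w = 0" "bil C z w \<noteq> 0"
    "bil A z z * bil A y y > 0" "bil A w w * bil A y y < 0"
proof -
  obtain x0 y0 z0 w0 where f0: "frame x0 y0 z0 w0" "C *v x0 = 0" "C *v y0 = 0"
    using frame_of_kernel[OF dimK] by blast
  obtain x y1 where f1: "frame x y1 z0 w0" "C *v x = 0" "C *v y1 = 0" "bil A x x \<noteq> 0"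
  proof (cases "bil A x0 x0 = 0 \<and> bil A y0 y0 = 0")
    case True
    \<comment> \<open>If both kernel vectors are isotropic, their sum is not: its value is twice the
      nonzero mixed term.\<close>
    then have "bil A x0 y0 \<noteq> 0" using kernel_nondegenerate f0 by blast
    then have "bil A (x0 + 1 *\<^sub>R y0) (x0 + 1 *\<^sub>R y0) \<noteq> 0"
      using True by (simp add: bil_simps bil_commute[OF symA, of y0 x0])
    then show thesis
      using f0 frame_swap12[OF frame_add_multiple[OF frame_swap12[OF f0(1)]], of 1]
      by (intro that[of "x0 + 1 *\<^sub>R y0" y0])
        (auto simp: matrix_vector_right_distrib dest: frame_swap12)
  next
    case False
    then show thesis using f0 frame_swap12[OF f0(1)] that by blast
  qed
  define y where "y = y1 + (- bil A x y1 / bil A x x) *\<^sub>R x"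
  have f2: "frame x y z0 w0" unfolding y_def by (rule frame_add_multiple[OF f1(1)])
  have Cy: "C *v y = 0"
    using f1 by (simp add: y_def matrix_vector_right_distrib matrix_vector_mult_diff_distrib matrix_vector_mult_scaleR)
  have xy: "bil A x y = 0" using f1(4) by (simp add: y_def bil_simps)
  then have yx: "bil A y x = 0" using bil_commute[OF symA] by metis
  have yy: "bil A y y \<noteq> 0"
    using kernel_nondegenerate[OF frame_swap12[OF f2] Cy f1(2)] yx by blast
  define z1 where "z1 = z0 + (- bil A x z0 / bil A x x) *\<^sub>R x + (- bil A y z0 / bil A y y) *\<^sub>R y"
  define w1 where "w1 = w0 + (- bil A x w0 / bil A x x) *\<^sub>R x + (- bil A y w0 / bil A y y) *\<^sub>R y"
  have o1: "bil A x z1 = 0" "bil A x w1 = 0" "bil A y z1 = 0" "bil A y w1 = 0"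
    using xy yx yy f1(4) by (simp_all add: z1_def w1_def bil_simps)
  have f3: "frame x y z1 w1"
    using frame_change34[OF f2, of 1 1 0 0 "- bil A x z0 / bil A x x" "- bil A y z0 / bil A y y"
        "- bil A x w0 / bil A x x" "- bil A y w0 / bil A y y"] by (simp add: z1_def w1_def)
  obtain k1 where k1: "k1 < 0" "\<And>s. (s * bil A z1 z1 + bil C z1 z1) * (s * bil A w1 w1 + bil C w1 w1)
     - (s * bil A z1 w1 + bil C z1 w1)\<^sup>2 = k1 * ((s - d)\<^sup>2 + b\<^sup>2)"
    using complement_negative[OF f3 f1(2) Cy xy o1 f1(4) yy] by blast
  have pos: "(s - d)\<^sup>2 + b\<^sup>2 > 0" for s using b by (simp add: sum_power2_gt_zero_iff)
  \<comment> \<open>At \<open>s = 0\<close> the block determinant is that of \<open>C\<close> on the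
    complement; being negative, it makes \<open>C\<close> hyperbolic there.\<close>
  have "bil C z1 z1 * bil C w1 w1 - (bil C z1 w1)\<^sup>2 < 0"
    using k1(2)[of 0] mult_neg_pos[OF k1(1) pos[of 0]] by simp
  then obtain g h i j where iso: "g * j - h * i \<noteq> 0"
    "bil C z1 z1 * g\<^sup>2 + 2 * bil C z1 w1 * g * h + bil C w1 w1 * h\<^sup>2 = 0"
    "bil C z1 z1 * i\<^sup>2 + 2 * bil C z1 w1 * i * j + bil C w1 w1 * j\<^sup>2 = 0"
    by (rule isotropic_pair)
  define z w where "z = g *\<^sub>R z1 + h *\<^sub>R w1" and "w = i *\<^sub>R z1 + j *\<^sub>R w1"
  have f4: "frame x y z w"
    using frame_change34[OF f3 iso(1), of 0 0 0 0] by (simp add: z_def w_def)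
  have o2: "bil A x z = 0" "bil A x w = 0" "bil A y z = 0" "bil A y w = 0"
    using o1 by (simp_all add: z_def w_def bil_simps)
  have Czw: "bil C z z = 0" "bil C w w = 0"
    using iso(2,3) by (simp_all add: z_def w_def bil_simps bil_commute[OF symC, of w1 z1] power2_eq_square algebra_simps)
  obtain k where k: "k < 0" "\<And>s. (s * bil A z z + bil C z z) * (s * bil A w w + bil C w w)
     - (s * bil A z w + bil C z w)\<^sup>2 = k * ((s - d)\<^sup>2 + b\<^sup>2)" "k = bil A z z * bil A w w - (bil A z w)\<^sup>2"
    using complement_negative[OF f4 f1(2) Cy xy o2 f1(4) yy] by blast
  have neg: "(s * bil A z z) * (s * bil A w w) - (s * bil A z w + bil C z w)\<^sup>2 < 0" for s
    using k(2)[of s] mult_neg_pos[OF k(1) pos[of s]] Czw by simp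
  have m: "bil C z w \<noteq> 0" using neg[of 0] by auto
  \<comment> \<open>With both \<open>C\<close>-diagonal entries zero, choosing \<open>s\<close> so
    that the off-diagonal entry of the pencil vanishes isolates the product of the
    \<open>A\<close>-diagonal entries.\<close>
  have pr: "bil A z z * bil A w w < 0"
  proof (cases "bil A z w = 0")
    case False
    define s where "s = - bil C z w / bil A z w"
    have "s\<^sup>2 * (bil A z z * bil A w w) < 0"
    proof -
      have "s * bil A z w + bil C z w = 0" using False by (simp add: s_def)
      then show ?thesis using neg[of s] by (simp add: power2_eq_square mult_ac)
    qed
    then show ?thesis by (simp add: mult_less_0_iff)
  qed (use k in auto)
  \<comment> \<open>The diagonal values of \<open>A\<close> at \<open>z\<close> and \<open>w\<close>
    have opposite signs; the names are exchanged if necessary so that \<open>z\<close> agrees in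
    sign with \<open>y\<close>.\<close>
  show thesis
  proof (cases "bil A z z * bil A y y > 0")
    case True
    then have "bil A w w * bil A y y < 0" using pr by (auto simp: mult_less_0_iff zero_less_mult_iff)
    then show thesis using that[of x y z w] f1 Cy xy o2 yy Czw m True by blast
  next
    case False
    then have "bil A w w * bil A y y > 0" "bil A z z * bil A y y < 0"
      using pr yy by (auto simp: mult_less_0_iff zero_less_mult_iff)
    moreover have "bil C w z \<noteq> 0" using m bil_commute[OF symC] by metis
    ultimately show thesis using that[of x y w z] f1 Cy xy o2 yy Czw by blast
  qed
qed

end

subsection \<open>Complex points\<close>

definition cmat :: "real^4^4 \<Rightarrow> complex^4^4" where
  "cmat M = (\<chi> i j. complex_of_real (M $ i $ j))"

lemma cquad_cbil: "cquad M v = cbil (cmat M) v v"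
  by (simp add: cquad_def cbil_def cmat_def)

lemma cbil_add_left: "cbil Q (u + v) w = cbil Q u w + cbil Q v w"
  and cbil_add_right: "cbil Q w (u + v) = cbil Q w u + cbil Q w v"
  and cbil_scale_left: "cbil Q (a *s v) w = a * cbil Q v w"
  and cbil_scale_right: "cbil Q w (a *s v) = a * cbil Q w v"
  by (simp_all add: cbil_def sum_4 algebra_simps)

lemma cbil_cvec: "cbil (cmat M) (cvec u) (cvec v) = complex_of_real (bil M u v)"
  by (simp add: cbil_def cmat_def cvec_def bil_def inner_vec_def matrix_vector_mult_def sum_distrib_left
      mult.assoc)

lemma clin_cvec: "clin (cvec (M *v u)) v = cbil (cmat M) v (cvec u)"
  by (simp add: clin_def cbil_def cmat_def cvec_def matrix_vector_mult_def sum_4 algebra_simps)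

lemma cvec_eq_0_iff: "cvec u = 0 \<longleftrightarrow> u = 0"
  by (simp add: cvec_def vec_eq_iff)

lemma cquad_diff: "cquad (l *\<^sub>R A - B) v = complex_of_real l * cquad A v - cquad B v"
  by (simp add: cquad_def sum_4 algebra_simps)

text \<open>The plane is the polar plane of \<open>w\<close> with respect to \<open>C\<close>. In
  the normal form it is one of the two planes into which \<open>C\<close> splits, the one where the
  coordinate along \<open>z\<close> vanishes, and it contains \<open>w\<close> itself.\<close>

definition conic_at :: "real^4^4 \<Rightarrow> real^4^4 \<Rightarrow> real^4 \<Rightarrow> (complex^4) set" where
  "conic_at A C w = conic_set (cvec (C *v w)) (cmat A)"

lemma real_pts_conic_at: "real_pts (conic_at A C w) = {u. u \<noteq> 0 \<and> bil C u w = 0 \<and> bil A u u = 0}"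
  by (auto simp: real_pts_def conic_at_def conic_set_def clin_cvec cbil_cvec cvec_eq_0_iff)

text \<open>Since \<open>z\<close> has the sign opposite to both \<open>x\<close> and
  \<open>y\<close>, for every real \<open>t\<close> some multiple of \<open>z\<close> completes
  \<open>x + t *\<^sub>R y\<close> to a point of the conic. These points are projectively distinct:
  pairing with \<open>x\<close> fixes the scale, and pairing with \<open>y\<close> then recovers
  \<open>t\<close>.\<close>

lemma real_conic_of_signature:
  assumes orth: "bil A x y = 0" "bil A y x = 0" "bil A x z = 0" "bil A z x = 0"
      "bil A y z = 0" "bil A z y = 0"
    and sgn: "bil A x x * bil A z z < 0" "bil A y y * bil A z z < 0"
    and plane: "bil C x w = 0" "bil C y w = 0" "bil C z w = 0"
  shows "real_conic (conic_at A C w)"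
proof -
  define \<alpha> \<beta> \<gamma> where abc: "\<alpha> = bil A x x" "\<beta> = bil A y y" "\<gamma> = bil A z z"
  define r where "r t = sqrt ((\<alpha> + \<beta> * t\<^sup>2) / (- \<gamma>))" for t
  define P where "P t = x + t *\<^sub>R y + r t *\<^sub>R z" for t
  have nz: "\<alpha> \<noteq> 0" "\<beta> \<noteq> 0" "\<gamma> \<noteq> 0" using sgn by (auto simp: abc)
  have "0 \<le> (\<alpha> + \<beta> * t\<^sup>2) / (- \<gamma>)" for t
  proof -
    have "0 \<le> - (\<alpha> * \<gamma>) - (\<beta> * \<gamma>) * t\<^sup>2"
      using sgn mult_nonneg_nonneg[of "- (\<beta> * \<gamma>)" "t\<^sup>2"] by (simp add: abc)
    also have "\<dots> = (\<alpha> + \<beta> * t\<^sup>2) / (- \<gamma>) * \<gamma>\<^sup>2"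
      using nz by (simp add: field_simps power2_eq_square)
    finally show ?thesis using nz by (simp only: zero_le_mult_iff) auto
  qed
  then have r2: "(r t)\<^sup>2 = (\<alpha> + \<beta> * t\<^sup>2) / (- \<gamma>)" for t by (simp add: r_def)
  have Px: "bil A x (P t) = \<alpha>" and Py: "bil A y (P t) = \<beta> * t" for t
    using orth by (simp_all add: P_def bil_simps abc)
  have "bil A (P t) (P t) = \<alpha> + \<beta> * t\<^sup>2 + \<gamma> * (r t)\<^sup>2" for t
    using orth by (simp add: P_def bil_simps abc power2_eq_square)
  then have "bil A (P t) (P t) = 0" for t using nz by (simp add: r2)
  moreover have "bil C (P t) w = 0" for t using plane by (simp add: P_def bil_simps)
  moreover have "P t \<noteq> 0" for t using Px[of t] nz by (auto simp: bil_simps)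
  ultimately have sub: "range (\<lambda>t. pclass (P t)) \<subseteq> pclass ` real_pts (conic_at A C w)"
    by (auto simp: real_pts_conic_at)
  have "inj (\<lambda>t. pclass (P t))"
  proof (rule injI)
    fix t u assume eq: "pclass (P t) = pclass (P u)"
    have "P u \<in> pclass (P u)" unfolding pclass_def by (auto intro: exI[of _ 1])
    then obtain k where k: "P u = k *\<^sub>R P t" unfolding eq[symmetric] by (auto simp: pclass_def)
    have "\<alpha> = k * \<alpha>" using Px[of u] Px[of t] by (simp add: k bil_simps)
    moreover have "\<beta> * u = k * (\<beta> * t)" by (metis k bil_scale_right Py)
    ultimately show "t = u" using nz by simp
  qed
  then have "infinite (range (\<lambda>t. pclass (P t)))"
    by (simp add: finite_image_iff infinite_UNIV_char_0)
  then show ?thesis unfolding real_conic_def using sub finite_subset by blast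
qed

text \<open>For \<open>\<eta> \<noteq> 0\<close>, the last hypothesis says that the point
  \<open>(- \<theta>, \<eta>, 0)\<close> of the line does not lie outside the conic, so the line has
  to meet it. Concretely, with \<open>b = 1\<close> and \<open>a\<close> eliminated, a quadratic in
  \<open>d\<close> remains with leading coefficient \<open>P > 0\<close> and constant term
  \<open>R \<le> 0\<close>, hence with a real root.\<close>

lemma conic_meets_line:
  fixes \<alpha> \<beta> \<gamma> \<eta> \<theta> \<zeta> :: real
  assumes "\<alpha> * \<gamma> > 0" "\<alpha> * \<beta> < 0" and le: "\<theta>\<^sup>2 * \<alpha>\<^sup>2 \<le> - (\<eta>\<^sup>2 * (\<alpha> * \<beta>))"
  obtains a b d where "b \<noteq> 0" "\<alpha> * a\<^sup>2 + \<beta> * b\<^sup>2 + \<gamma> * d\<^sup>2 = 0" "\<eta> * a + \<theta> * b + \<zeta> * d = 0"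
proof (cases "\<eta> = 0")
  case True
  have "\<alpha> \<noteq> 0" using assms by auto
  then have "\<theta> = 0" using le True by (simp add: mult_le_0_iff)
  have "0 \<le> - \<beta> / \<alpha>" using assms(2) by (auto simp: mult_less_0_iff divide_le_0_iff)
  then have "\<alpha> * (sqrt (- \<beta> / \<alpha>))\<^sup>2 + \<beta> * 1\<^sup>2 + \<gamma> * 0\<^sup>2 = 0" using \<open>\<alpha> \<noteq> 0\<close> by simp
  then show thesis using that[of 1 "sqrt (- \<beta> / \<alpha>)" 0] True \<open>\<theta> = 0\<close> by simp
next
  case False
  define P Q R where "P = \<alpha>\<^sup>2 * \<zeta>\<^sup>2 + \<alpha> * \<gamma> * \<eta>\<^sup>2" and "Q = \<alpha>\<^sup>2 * \<theta> * \<zeta>"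
    and "R = \<alpha>\<^sup>2 * \<theta>\<^sup>2 + \<alpha> * \<beta> * \<eta>\<^sup>2"
  have "P > 0" using assms(1) False unfolding P_def by (intro add_nonneg_pos) auto
  have "R \<le> 0" using le by (simp add: R_def mult_ac)
  have D: "0 \<le> Q\<^sup>2 - P * R" using mult_nonneg_nonpos[of P R] \<open>P > 0\<close> \<open>R \<le> 0\<close>
    by (smt (verit) zero_le_power2)
  define d where "d = (- Q + sqrt (Q\<^sup>2 - P * R)) / P"
  have "(P * d + Q)\<^sup>2 = Q\<^sup>2 - P * R" using \<open>P > 0\<close> D by (simp add: d_def)
  then have "P * (P * d\<^sup>2 + 2 * Q * d + R) = 0" by (simp add: power2_eq_square algebra_simps)
  then have q: "P * d\<^sup>2 + 2 * Q * d + R = 0" using \<open>P > 0\<close> by simp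
  define a where "a = - (\<theta> + \<zeta> * d) / \<eta>"
  have a: "\<eta> * a = - (\<theta> + \<zeta> * d)" using False by (simp add: a_def)
  have "\<alpha> * \<eta>\<^sup>2 * (\<alpha> * a\<^sup>2 + \<beta> * 1\<^sup>2 + \<gamma> * d\<^sup>2) = \<alpha>\<^sup>2 * (\<eta> * a)\<^sup>2 + \<alpha> * \<eta>\<^sup>2 * (\<beta> + \<gamma> * d\<^sup>2)"
    by (simp add: power2_eq_square algebra_simps)
  also have "\<dots> = P * d\<^sup>2 + 2 * Q * d + R"
    unfolding a P_def Q_def R_def by (simp add: power2_eq_square algebra_simps)
  finally have "\<alpha> * a\<^sup>2 + \<beta> * 1\<^sup>2 + \<gamma> * d\<^sup>2 = 0" using q False assms(1) by auto
  then show thesis using that[of 1 a d] a by simp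
qed

section \<open>Base locus, real points and index of a pencil in normal form\<close>

locale normal_pencil =
  fixes A C :: "real^4^4" and x y z w :: "real^4"
  assumes symA: "transpose A = A" and symC: "transpose C = C"
    and Cx: "C *v x = 0" and Cy: "C *v y = 0"
    and orthA: "bil A x y = 0" "bil A x z = 0" "bil A x w = 0" "bil A y z = 0" "bil A y w = 0"
    and nonzeroA: "bil A x x \<noteq> 0" "bil A y y \<noteq> 0" "bil A z z \<noteq> 0" "bil A w w \<noteq> 0"
    and isoC: "bil C z z = 0" "bil C w w = 0" and Czw: "bil C z w \<noteq> 0"
begin

lemma orthA': "bil A y x = 0" "bil A z x = 0" "bil A w x = 0" "bil A z y = 0" "bil A w y = 0"
  using orthA bil_commute[OF symA] by metis+

lemma Cxy: "bil C u x = 0" "bil C u y = 0" "bil C x u = 0" "bil C y u = 0"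
proof -
  show "bil C u x = 0" "bil C u y = 0" using Cx Cy by (simp_all add: bil_def)
  then show "bil C x u = 0" "bil C y u = 0" using bil_commute[OF symC] by simp_all
qed

text \<open>The locale prescribes no signs, so exchanging \<open>z\<close> and \<open>w\<close> is a
  symmetry, and what is proved for \<open>conic_at A C w\<close> transfers to
  \<open>conic_at A C z\<close>.\<close>

lemma swap: "normal_pencil A C x y w z"
proof -
  have "bil C w z \<noteq> 0" using Czw bil_commute[OF symC] by metis
  then show ?thesis
    using symA symC Cx Cy orthA nonzeroA isoC by unfold_locales auto
qed

text \<open>Pairing a linear relation with \<open>x\<close> and \<open>y\<close> under
  \<open>A\<close>, and with \<open>z\<close> and \<open>w\<close> under \<open>C\<close>, isolates
  one coefficient each time.\<close>

lemma frame: "frame x y z w"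
  unfolding frame_def
proof (intro allI impI)
  fix a b c d assume 0: "a *\<^sub>R x + b *\<^sub>R y + c *\<^sub>R z + d *\<^sub>R w = 0" (is "?u = 0")
  have "bil A x ?u = 0" "bil A y ?u = 0" "bil C z ?u = 0" "bil C ?u w = 0"
    unfolding 0 by (simp_all add: bil_simps)
  then show "a = 0 \<and> b = 0 \<and> c = 0 \<and> d = 0"
    using orthA orthA' nonzeroA isoC Czw by (simp add: bil_simps Cxy)
qed

lemma real_coordinates: "\<exists>a b c d. u = a *\<^sub>R x + b *\<^sub>R y + c *\<^sub>R z + d *\<^sub>R w"
proof -
  define T where "T = cols4 x y z w"
  have "invertible T" using frame_det[OF frame] by (simp add: T_def invertible_det_nz)
  then obtain T' where "T ** T' = mat 1" unfolding invertible_def by blast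
  then have "T *v (T' *v u) = u" by (simp add: matrix_vector_mul_assoc)
  then have "u = (\<Sum>i\<in>UNIV. (T' *v u) $ i *s column i T)" by (simp add: matrix_mult_sum)
  then show ?thesis unfolding sum_4 T_def column_cols4 scalar_mult_eq_scaleR by blast
qed

definition pt :: "complex \<Rightarrow> complex \<Rightarrow> complex \<Rightarrow> complex \<Rightarrow> complex^4" where
  "pt a b c d = a *s cvec x + b *s cvec y + c *s cvec z + d *s cvec w"

lemma complex_coordinates: "\<exists>a b c d. v = pt a b c d"
proof -
  obtain a b c d where re: "(\<chi> i. Re (v $ i)) = a *\<^sub>R x + b *\<^sub>R y + c *\<^sub>R z + d *\<^sub>R w"
    using real_coordinates by blast
  obtain a' b' c' d' where im: "(\<chi> i. Im (v $ i)) = a' *\<^sub>R x + b' *\<^sub>R y + c' *\<^sub>R z + d' *\<^sub>R w"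
    using real_coordinates by blast
  have "v = pt (Complex a a') (Complex b b') (Complex c c') (Complex d d')"
    using re im by (simp add: vec_eq_iff pt_def cvec_def complex_eq_iff)
  then show ?thesis by blast
qed

lemma cbil_pt:
  "cbil (cmat A) (pt a b c d) (cvec x) = a * bil A x x"
  "cbil (cmat A) (pt a b c d) (cvec y) = b * bil A y y"
  "cbil (cmat C) (pt a b c d) (cvec z) = d * bil C w z"
  "cbil (cmat C) (pt a b c d) (cvec w) = c * bil C z w"
  "cbil (cmat A) (pt a b 0 d) (cvec w) = d * bil A w w"
  by (simp_all add: pt_def cbil_add_left cbil_scale_left cbil_cvec orthA orthA' Cxy isoC)

lemma cquad_C_pt: "cquad C (pt a b c d) = 2 * c * d * bil C z w"
  using bil_commute[OF symC, of w z]
  by (simp add: cquad_cbil pt_def cbil_add_left cbil_scale_left cbil_add_right cbil_scale_right cbil_cvec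
      Cxy isoC)

lemma mem_conic_at_pt:
  "pt a b c d \<in> conic_at A C w \<longleftrightarrow> pt a b c d \<noteq> 0 \<and> c = 0 \<and> cquad A (pt a b c d) = 0"
  using Czw by (simp add: conic_at_def conic_set_def clin_cvec cbil_pt cquad_cbil)

text \<open>The plane is spanned by \<open>x\<close>, \<open>y\<close>, \<open>w\<close>, on which
  \<open>A\<close> is diagonal with nonzero entries. A nonzero vector of the plane therefore pairs
  nontrivially with one of the three.\<close>

lemma is_conic_conic_at: "is_conic (conic_at A C w)"
  unfolding is_conic_def
proof (intro exI conjI)
  show "conic_at A C w = conic_set (cvec (C *v w)) (cmat A)" by (simp add: conic_at_def)
  show "cvec (C *v w) \<noteq> 0" using Czw by (auto simp: cvec_eq_0_iff bil_def)
  show "transpose (cmat A) = cmat A"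
    using symA by (simp add: cmat_def transpose_def vec_eq_iff)
  show "\<forall>v. v \<noteq> 0 \<and> clin (cvec (C *v w)) v = 0 \<longrightarrow>
      (\<exists>u. clin (cvec (C *v w)) u = 0 \<and> cbil (cmat A) v u \<noteq> 0)"
  proof (intro allI impI)
    fix v assume v: "v \<noteq> 0 \<and> clin (cvec (C *v w)) v = 0"
    obtain a b c d where pt: "v = pt a b c d" using complex_coordinates by blast
    have c: "c = 0" using v Czw by (simp add: pt clin_cvec cbil_pt)
    have "a \<noteq> 0 \<or> b \<noteq> 0 \<or> d \<noteq> 0" using v c by (auto simp: pt pt_def)
    then have "\<exists>u\<in>{x, y, w}. cbil (cmat A) v (cvec u) \<noteq> 0"
      using nonzeroA by (auto simp: pt c cbil_pt)
    moreover have "clin (cvec (C *v w)) (cvec u) = 0" if "u \<in> {x, y, w}" for u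
      using that isoC by (auto simp: clin_cvec cbil_cvec Cxy)
    ultimately show "\<exists>u. clin (cvec (C *v w)) u = 0 \<and> cbil (cmat A) v u \<noteq> 0" by blast
  qed
qed

text \<open>In coordinates \<open>C\<close> is a constant times the product of the coordinates along
  \<open>z\<close> and \<open>w\<close>, so its quadric is a pair of planes and each plane cuts a
  conic out of the quadric of \<open>A\<close>.\<close>

lemma base_locus:
  "{v. v \<noteq> 0 \<and> cquad A v = 0 \<and> cquad C v = 0} = conic_at A C w \<union> conic_at A C z"
proof (rule set_eqI)
  fix v
  obtain a b c d where v: "v = pt a b c d" using complex_coordinates by blast
  interpret sw: normal_pencil A C x y w z by (rule swap)
  have v': "v = sw.pt a b d c" unfolding v pt_def sw.pt_def by (simp add: add_ac)
  have "v \<in> conic_at A C w \<longleftrightarrow> v \<noteq> 0 \<and> c = 0 \<and> cquad A v = 0" unfolding v by (rule mem_conic_at_pt)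
  moreover have "v \<in> conic_at A C z \<longleftrightarrow> v \<noteq> 0 \<and> d = 0 \<and> cquad A v = 0"
    unfolding v' by (rule sw.mem_conic_at_pt)
  moreover have "cquad C v = 0 \<longleftrightarrow> c = 0 \<or> d = 0" using Czw unfolding v by (simp add: cquad_C_pt)
  ultimately show "v \<in> {v. v \<noteq> 0 \<and> cquad A v = 0 \<and> cquad C v = 0} \<longleftrightarrow> v \<in> conic_at A C w \<union> conic_at A C z"
    by blast
qed

text \<open>On the plane of the conic \<open>A\<close> is definite; multiplying by
  \<open>bil A y y\<close> makes it positive whatever its sign.\<close>

lemma no_real_points:
  assumes "bil A x x * bil A y y > 0" "bil A w w * bil A y y > 0"
  shows "real_pts (conic_at A C w) = {}"
proof -
  have "u = 0" if u: "bil C u w = 0" "bil A u u = 0" for u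
  proof -
    obtain a b c d where uu: "u = a *\<^sub>R x + b *\<^sub>R y + c *\<^sub>R z + d *\<^sub>R w"
      using real_coordinates by blast
    have c: "c = 0" using u(1) Czw isoC by (simp add: uu bil_simps Cxy)
    have "bil A u u = a\<^sup>2 * bil A x x + b\<^sup>2 * bil A y y + d\<^sup>2 * bil A w w"
      by (simp add: uu c bil_simps orthA orthA' power2_eq_square)
    then have "a\<^sup>2 * (bil A x x * bil A y y) + b\<^sup>2 * (bil A y y)\<^sup>2 + d\<^sup>2 * (bil A w w * bil A y y)
        = bil A y y * bil A u u"
      by (simp add: power2_eq_square algebra_simps)
    also have "\<dots> = 0" using u by simp
    finally have sum: "a\<^sup>2 * (bil A x x * bil A y y) + b\<^sup>2 * (bil A y y)\<^sup>2 + d\<^sup>2 * (bil A w w * bil A y y) = 0" .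
    have "0 \<le> a\<^sup>2 * (bil A x x * bil A y y)" "0 \<le> b\<^sup>2 * (bil A y y)\<^sup>2" "0 \<le> d\<^sup>2 * (bil A w w * bil A y y)"
      using assms by auto
    with sum have "a\<^sup>2 * (bil A x x * bil A y y) = 0" "b\<^sup>2 * (bil A y y)\<^sup>2 = 0"
      "d\<^sup>2 * (bil A w w * bil A y y) = 0" by linarith+
    then have "a = 0" "b = 0" "d = 0" using assms by auto
    then show ?thesis by (simp add: uu c)
  qed
  then show ?thesis unfolding real_pts_conic_at by blast
qed

text \<open>The plane with normal \<open>h\<close> cuts the plane of the conic in the line with
  coefficients \<open>h \<bullet> x\<close>, \<open>h \<bullet> y\<close>,
  \<open>h \<bullet> w\<close>. The criterion involves only \<open>x\<close> and \<open>y\<close>,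
  which both conic planes share, so it can be compared between the two conics.\<close>

lemma conic_meets_plane:
  assumes "bil A x x * bil A w w > 0" "bil A x x * bil A y y < 0"
    and "(h \<bullet> y)\<^sup>2 * (bil A x x)\<^sup>2 \<le> - ((h \<bullet> x)\<^sup>2 * (bil A x x * bil A y y))"
  shows "\<exists>u\<in>real_pts (conic_at A C w). h \<bullet> u = 0"
proof -
  obtain a b d where abd: "b \<noteq> 0" "bil A x x * a\<^sup>2 + bil A y y * b\<^sup>2 + bil A w w * d\<^sup>2 = 0"
    "(h \<bullet> x) * a + (h \<bullet> y) * b + (h \<bullet> w) * d = 0"
    using conic_meets_line[OF assms] by blast
  define u where "u = a *\<^sub>R x + b *\<^sub>R y + d *\<^sub>R w"
  have "bil A y u = b * bil A y y" by (simp add: u_def bil_simps orthA orthA')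
  then have "u \<noteq> 0" using abd(1) nonzeroA by (auto simp: bil_simps)
  moreover have "bil C u w = 0" by (simp add: u_def bil_simps Cxy isoC)
  moreover have "bil A u u = 0"
    using abd(2) by (simp add: u_def bil_simps orthA orthA' power2_eq_square mult_ac)
  moreover have "h \<bullet> u = 0" using abd(3) by (simp add: u_def inner_add_right mult.commute)
  ultimately show ?thesis by (auto simp: real_pts_conic_at)
qed

text \<open>The pencil is diagonal on \<open>x\<close> and \<open>y\<close> with values proportional
  to \<open>s\<close>, while the block of \<open>z\<close> and \<open>w\<close> is indefinite for
  every nonzero \<open>s\<close> and contributes exactly one.\<close>

lemma pos_eig_pencil:
  assumes s: "s \<noteq> 0" and sgn: "bil A z z * bil A w w < 0"
  shows "pos_eig (s *\<^sub>R A + C) =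
    (if s * bil A x x > 0 then 1 else 0) + (if s * bil A y y > 0 then 1 else 0) + 1"
proof -
  define M where "M = s *\<^sub>R A + C"
  have symM: "transpose M = M"
    using symA symC unfolding M_def by (simp add: transpose_def vec_eq_iff)
  have bilM: "bil M u v = s * bil A u v + bil C u v" for u v
    by (simp add: M_def bil_matrix_add bil_matrix_scale)
  have zz: "bil M z z = s * bil A z z" by (simp add: bilM isoC)
  have zz0: "bil M z z \<noteq> 0" using zz s nonzeroA by simp
  \<comment> \<open>Completing the square makes the block diagonal without changing its determinant,
    whose sign is negative.\<close>
  define w' where "w' = w - (bil M z w / bil M z z) *\<^sub>R z"
  have zw': "bil M z w' = 0" "bil M w' z = 0"
    using zz0 bil_commute[OF symM] by (auto simp: w'_def bil_simps)
  have "bil M w' w' = bil M w w - (bil M z w)\<^sup>2 / bil M z z"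
    using zz0 bil_commute[OF symM, of w z] by (simp add: w'_def bil_simps field_simps power2_eq_square)
  then have "bil M z z * bil M w' w' = s\<^sup>2 * (bil A z z * bil A w w) - (bil M z w)\<^sup>2"
    using zz0 by (simp add: right_diff_distrib zz bilM[of w w] isoC power2_eq_square)
  also have "\<dots> < 0" using mult_pos_neg[of "s\<^sup>2", OF _ sgn] s by (smt (verit) zero_le_power2 zero_less_power2)
  finally have neg: "bil M z z * bil M w' w' < 0" .
  define f :: "4 \<Rightarrow> real^4" where "f i = (if i = 1 then x else if i = 2 then y else if i = 3 then z else w')" for i
  have f: "f 1 = x" "f 2 = y" "f 3 = z" "f 4 = w'" by (simp_all add: f_def)
  have "bil M (f i) (f j) = 0" if "i \<noteq> j" for i j
    using that exhaust_4[of i] exhaust_4[of j] zw'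
    by (auto simp: f bilM[of x] bilM[of y] bilM[of _ x] bilM[of _ y] orthA orthA' Cxy w'_def bil_simps)
  moreover have "bil M (f i) (f i) \<noteq> 0" for i
    using exhaust_4[of i] neg s nonzeroA by (auto simp: f bilM[of x] bilM[of y] Cxy)
  ultimately have "pos_eig M = card {i. bil M (f i) (f i) > 0}" by (rule pos_eig_eq[OF symM])
  also have "\<dots> = (\<Sum>i\<in>UNIV. if bil M (f i) (f i) > 0 then 1 else 0)"
    by (simp add: sum.If_cases)
  also have "\<dots> = (if s * bil A x x > 0 then 1 else 0) + (if s * bil A y y > 0 then 1 else 0) + 1"
    using neg unfolding sum_4 f by (auto simp: bilM[of x] bilM[of y] Cxy mult_less_0_iff)
  finally show ?thesis by (simp add: M_def)
qed

end

section \<open>Classification by whether \<open>A\<close> is definite or indefinite on the kernel of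
  \<open>C\<close>\<close>

theorem theorem14:
  fixes A B :: "real^4^4" and l0 :: real
  assumes symA: "sym4 A" and symB: "sym4 B"
    and nonzero: "\<exists>t. det (t *\<^sub>R A - B) \<noteq> 0"
    and roots: "\<exists>c a b. c \<noteq> 0 \<and> b \<noteq> 0 \<and>
        (\<forall>t. det (t *\<^sub>R A - B) = c * (t - l0)^2 * ((t - a)^2 + b^2))"
    and segre: "num_jordan_blocks (matrix_inv A ** B) l0 = 2"
  shows "(index_seq_is A B l0 1 3 \<or> index_seq_is A B l0 2 2)
    \<and> (index_seq_is A B l0 1 3 \<longrightarrow>
         (\<exists>C1 C2. is_conic C1 \<and> is_conic C2 \<and> QSIC A B = C1 \<union> C2 \<and>
            real_conic C1 \<and> imaginary_conic C2))
    \<and> (index_seq_is A B l0 2 2 \<longrightarrow>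
         (\<exists>C1 C2. is_conic C1 \<and> is_conic C2 \<and> C1 \<noteq> C2 \<and> QSIC A B = C1 \<union> C2 \<and>
            real_conic C1 \<and> real_conic C2 \<and>
            \<not> (\<exists>h. h \<noteq> 0 \<and> ellipse_in h C1 \<and> ellipse_in h C2)))"
proof -
  obtain c a b where c: "c \<noteq> 0" and b: "b \<noteq> 0"
    and det: "\<And>t. det (t *\<^sub>R A - B) = c * (t - l0)^2 * ((t - a)^2 + b^2)"
    using roots by blast
  define C where "C = l0 *\<^sub>R A - B"
  have tA: "transpose A = A" and tB: "transpose B = B" using symA symB by (simp_all add: sym4_def)
  have tC: "transpose C = C" using tA tB unfolding C_def by (simp add: transpose_def vec_eq_iff)
  have shift: "t *\<^sub>R A - B = (t - l0) *\<^sub>R A + C" for t by (simp add: C_def algebra_simps)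
  have det_C: "det (s *\<^sub>R A + C) = c * s\<^sup>2 * ((s - (a - l0))\<^sup>2 + b\<^sup>2)" for s
    using det[of "s + l0"] unfolding shift by (simp add: algebra_simps)
  have "det A \<noteq> 0" using det_pencil_leading_coeff[OF det] c by simp
  then have "\<exists>A'. A ** A' = mat 1 \<and> A' ** A = mat 1"
    by (simp flip: invertible_det_nz add: invertible_def)
  then have "A ** matrix_inv A = mat 1 \<and> matrix_inv A ** A = mat 1"
    unfolding matrix_inv_def by (rule someI_ex)
  then have inv: "A *v (matrix_inv A *v v) = v" "matrix_inv A *v (A *v v) = v" for v
    by (simp_all add: matrix_vector_mul_assoc)
  \<comment> \<open>The kernel of \<open>C\<close> is the eigenspace of
    \<open>matrix_inv A ** B\<close> for \<open>l0\<close>, so the number of Jordan blocks is its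
    dimension.\<close>
  have "C *v v = 0 \<longleftrightarrow> (matrix_inv A ** B) *v v = l0 *\<^sub>R v" for v
  proof -
    have "C *v v = 0 \<longleftrightarrow> B *v v = A *v (l0 *\<^sub>R v)"
      by (auto simp: C_def matrix_vector_mult_diff_rdistrib matrix_vector_mult_scaleR
          scaleR_matrix_vector_assoc[symmetric])
    also have "\<dots> \<longleftrightarrow> matrix_inv A *v (B *v v) = l0 *\<^sub>R v" using inv by metis
    finally show ?thesis by (simp add: matrix_vector_mul_assoc)
  qed
  then have "dim {v. C *v v = 0} = 2" using segre by (simp add: num_jordan_blocks_def)
  from pencil_normal_form[OF tA tC c b det_C this]
  obtain x y z w where nf: "C *v x = 0" "C *v y = 0"
    "bil A x y = 0" "bil A x z = 0" "bil A x w = 0" "bil A y z = 0" "bil A y w = 0"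
    "bil A x x \<noteq> 0" "bil A y y \<noteq> 0" "bil C z z = 0" "bil C w w = 0" "bil C z w \<noteq> 0"
    and zy: "bil A z z * bil A y y > 0" and wy: "bil A w w * bil A y y < 0"
    by blast
  interpret normal_pencil A C x y z w
    using nf zy wy tA tC by unfold_locales auto
  interpret sw: normal_pencil A C x y w z by (rule swap)
  let ?e = "bil A x x" and ?f = "bil A y y"
  have zw: "bil A z z * bil A w w < 0" using zy wy by (auto simp: mult_less_0_iff zero_less_mult_iff)
  have Id: "Id A B t = (if (t - l0) * ?e > 0 then 1 else 0) + (if (t - l0) * ?f > 0 then 1 else 0) + 1"
    if "t \<noteq> l0" for t
    unfolding Id_def shift using pos_eig_pencil[OF _ zw] that by simp
  have QSIC: "QSIC A B = conic_at A C w \<union> conic_at A C z"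
    unfolding QSIC_def base_locus[symmetric] by (auto simp: C_def cquad_diff)
  note conics = is_conic_conic_at sw.is_conic_conic_at
  show ?thesis
  proof (cases "?e * ?f > 0")
    case True
    have "Id A B t = (if (t - l0) * ?f > 0 then 3 else 1)" if "t \<noteq> l0" for t
      using Id[OF that] True by (auto simp: zero_less_mult_iff)
    \<comment> \<open>Both kernel directions change sign together at \<open>l0\<close>. Reversal and
      complement fix the pair \<open>(2, 2)\<close>, so a single index different from 2 excludes
      it.\<close>
    then have idx: "has_index_seq A B l0 1 3 \<or> has_index_seq A B l0 3 1"
      and odd: "Id A B (l0 + 1) \<noteq> 2"
      using nf(9) by (auto simp: has_index_seq_def zero_less_mult_iff)
    have "index_seq_is A B l0 1 3"
      using idx unfolding index_seq_is_def seq_equiv_def by auto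
    moreover have "\<not> index_seq_is A B l0 2 2"
      using odd by (auto simp: index_seq_is_def seq_equiv_def has_index_seq_def)
    moreover have "?e * bil A w w < 0"
      using True wy by (auto simp: mult_less_0_iff zero_less_mult_iff)
    then have "real_conic (conic_at A C w)"
      using wy orthA orthA' Cxy isoC
      by (intro real_conic_of_signature[of A x y w]) (auto simp: mult.commute)
    \<comment> \<open>The plane of this conic is spanned by \<open>x\<close>, \<open>y\<close>,
      \<open>z\<close>, where all three diagonal values of \<open>A\<close> have the same
      sign.\<close>
    moreover have "imaginary_conic (conic_at A C z)"
      using sw.no_real_points[OF True zy] by (simp add: imaginary_conic_def real_conic_def)
    ultimately show ?thesis using conics QSIC by blast
  next
    case False
    then have ef: "?e * ?f < 0" using nf(8,9) by (metis linorder_neqE_linordered_idom mult_eq_0_iff)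
    have Id2: "Id A B t = 2" if "t \<noteq> l0" for t
      using Id[OF that] ef that by (auto simp: mult_less_0_iff zero_less_mult_iff)
    have "index_seq_is A B l0 2 2"
      unfolding index_seq_is_def seq_equiv_def has_index_seq_def using Id2
      by (intro exI[of _ 2]) auto
    moreover have "\<not> index_seq_is A B l0 1 3"
      using Id2[of "l0 + 1"] Id2[of "l0 - 1"] by (auto simp: index_seq_is_def seq_equiv_def has_index_seq_def)
    \<comment> \<open>Now \<open>w\<close> agrees in sign with \<open>x\<close>, and
      \<open>z\<close> with \<open>y\<close>. The exceptional sign thus sits at \<open>y\<close> for
      the conic spanned by \<open>x\<close>, \<open>y\<close>, \<open>w\<close>, and at
      \<open>x\<close> for the one spanned by \<open>x\<close>, \<open>y\<close>,
      \<open>z\<close>.\<close>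
    moreover have we: "?e * bil A w w > 0" and ze: "bil A z z * ?e < 0"
      using ef wy zy by (auto simp: mult_less_0_iff zero_less_mult_iff)
    have "real_conic (conic_at A C w)"
      using ef wy orthA orthA' Cxy isoC
      by (intro real_conic_of_signature[of A x w y]) (auto simp: mult.commute)
    moreover have "real_conic (conic_at A C z)"
      using ef ze orthA orthA' Cxy isoC
      by (intro real_conic_of_signature[of A y z x]) (auto simp: mult.commute)
    moreover have "conic_at A C w \<noteq> conic_at A C z"
    proof -
      \<comment> \<open>The factor \<open>k\<close> puts \<open>k *\<^sub>R y + w\<close> on the
        first conic; its nonzero coordinate along \<open>w\<close> keeps it off the plane of the
        second.\<close>
      define k where "k = sqrt (- bil A w w / ?f)"
      define u where "u = k *\<^sub>R y + w"
      have "0 \<le> - bil A w w / ?f" using wy by (auto simp: mult_less_0_iff divide_le_0_iff)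
      then have k: "k\<^sup>2 = - bil A w w / ?f" by (simp add: k_def)
      have Cu: "bil C u z \<noteq> 0" "bil C u w = 0" using sw.Czw by (simp_all add: u_def bil_simps Cxy isoC)
      have "bil A u u = k\<^sup>2 * ?f + bil A w w"
        by (simp add: u_def bil_simps orthA orthA' power2_eq_square)
      also have "\<dots> = 0" using k nf(9) by simp
      finally have "u \<in> real_pts (conic_at A C w)" "u \<notin> real_pts (conic_at A C z)"
        using Cu by (auto simp: real_pts_conic_at bil_simps)
      then show ?thesis by metis
    qed
    moreover have "\<not> (ellipse_in h (conic_at A C w) \<and> ellipse_in h (conic_at A C z))" for h
    proof
      assume "ellipse_in h (conic_at A C w) \<and> ellipse_in h (conic_at A C z)"
      then have miss: "\<not> (\<exists>u\<in>real_pts (conic_at A C w). h \<bullet> u = 0)"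
        "\<not> (\<exists>u\<in>real_pts (conic_at A C z). h \<bullet> u = 0)" by (auto simp: ellipse_in_def)
      \<comment> \<open>Exchanging both pairs lets the meeting criterion apply to the second conic
        with \<open>x\<close> and \<open>y\<close> in interchanged roles.\<close>
      interpret yx: normal_pencil A C y x w z
        using sw.normal_pencil_axioms orthA' unfolding normal_pencil_def by auto
      define E where "E = - (?e * ?f)"
      have E: "E > 0" using ef by (simp add: E_def)
      have 1: "(h \<bullet> y)\<^sup>2 * ?e\<^sup>2 > (h \<bullet> x)\<^sup>2 * E"
        using conic_meets_plane[of h] we ef miss(1) unfolding E_def by fastforce
      have 2: "(h \<bullet> x)\<^sup>2 * ?f\<^sup>2 > (h \<bullet> y)\<^sup>2 * E"
        using yx.conic_meets_plane[of h] zy ef miss(2) unfolding E_def by (fastforce simp: mult.commute)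
      \<comment> \<open>Scaling inequality 2 by \<open>E\<close> and inequality 1 by
        \<open>?f\<^sup>2\<close> gives a chain whose two ends coincide, because \<open>E\<close>
        squared is \<open>?e\<^sup>2 * ?f\<^sup>2\<close>.\<close>
      have "(h \<bullet> y)\<^sup>2 * E * E < (h \<bullet> x)\<^sup>2 * ?f\<^sup>2 * E" using 2 E by simp
      also have "\<dots> \<le> (h \<bullet> y)\<^sup>2 * ?e\<^sup>2 * ?f\<^sup>2"
        using mult_right_mono[OF less_imp_le[OF 1], of "?f\<^sup>2"] by (simp add: mult_ac)
      also have "\<dots> = (h \<bullet> y)\<^sup>2 * E * E" by (simp add: E_def power2_eq_square mult_ac)
      finally show False by simp
    qed
    ultimately show ?thesis using conics QSIC by blast
  qed
qed

end
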